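(* Let $R$ be a nc rational expression in $x_1,\dots,x_d$ over a field $\mathbb K$ and let $\mathcal R$ be a nc Fornasini--Marchesini realization of $R$ centred at $\underline Y\in(\mathbb K^{s\times s})^d$. Then $\mathcal R$ is minimal if and only if $\mathcal R$ is controllable and observable.
   Context: $\mathbb K$ is a field, $\mathbb N=\{1,2,\dots\}$, $d,s\in\mathbb N$; underlined letters denote tuples; $\otimes$ is the Kronecker product. NC rational expressions. A nc rational expression $R$ in $x_1,\dots,x_d$ over $\mathbb K$ is a formal expression obtained from nc polynomials in $\mathbb K\langle x_1,\dots,x_d\rangle$ by successive additions, multiplications and inversions. $dom_n(R)\subseteq(\mathbb K^{n\times n})^d$ is the set of $d$-tuples of $n\times n$ matrices at which all inverses occurring in $R$ exist (evaluating recursively), and $R(\underline X)\in\mathbb K^{n\times n}$ is the resulting value. Realizations. A nc Fornasini--Marchesini realization $\mathcal R$ centred at $\underline Y\in(\mathbb K^{s\times s})^d$, described by $(L,D,C,\underline{\mathbf A},\underline{\mathbf B})$, consists of a dimension $L\in\mathbb N$, linear mappings $\mathbf A_1,\dots,\mathbf A_d:\mathbb K^{s\times s}\to\mathbb K^{L\times L}$, $\mathbf B_1,\dots,\mathbf B_d:\mathbb K^{s\times s}\to\mathbb K^{L\times s}$ and matrices $C\in\mathbb K^{s\times L}$, $D\in\mathbb K^{s\times s}$. A linear mapping $\mathbf T$ on $s\times s$ matrices is extended to $X=[X_{ij}]_{i,j=1}^m\in\mathbb K^{sm\times sm}$ ($X_{ij}\in\mathbb K^{s\times s}$) by $(X)\mathbf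 T=[\mathbf T(X_{ij})]_{i,j=1}^m$. Put $DOM_{sm}(\mathcal R)=\{\underline X\in(\mathbb K^{sm\times sm})^d:\det(I_{Lm}-\sum_{k=1}^d(X_k-I_m\otimes Y_k)\mathbf A_k)\ne0\}$ and for such $\underline X$ $$\mathcal R(\underline X)=I_m\otimes D+(I_m\otimes C)\Big(I_{Lm}-\sum_{k=1}^d(X_k-I_m\otimes Y_k)\mathbf A_k\Big)^{-1}\sum_{k=1}^d(X_k-I_m\otimes Y_k)\mathbf B_k.$$ $\mathcal R$ is a realization of $R$ (centred at $\underline Y$) if $\underline Y\in dom_s(R)$ and for every $m\in\mathbb N$: $dom_{sm}(R)\subseteq DOM_{sm}(\mathcal R)$ and $R(\underline X)=\mathcal R(\underline X)$ for all $\underline X\in dom_{sm}(R)$. It is minimal if its dimension $L$ is the smallest among all nc Fornasini--Marchesini realizations of $R$ centred at $\underline Y$. $\mathcal R$ is controllable if the vectors $\mathbf A_{i_1}(X_1)\cdots\mathbf A_{i_\ell}(X_\ell)\mathbf B_k(X_{\ell+1})u$ ($\ell\ge0$, $1\le i_1,\dots,i_\ell,k\le d$, $X_j\in\mathbb K^{s\times s}$, $u\in\mathbb K^s$) span $\mathbb K^L$; observable if the only $v\in\mathbb K^L$ with $C\mathbf A_{i_1}(X_1)\cdots\mathbf A_{i_\ell}(X_\ell)v=0$ for all $\ell\ge0$, $1\le i_j\le d$, $X_j\in\mathbb K^{s\times s}$ is $v=0$.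
   Formalization: Realizations of dimension L = 0 are allowed, also as competitors in "minimal"; with L ≥ 1 the claim fails, e.g. for R = 0 the realization with L = 1 and A = B = C = D = 0 is minimal but neither controllable nor observable. *)

theory Defs
  imports
    "HOL-Library.Poly_Mapping"
    "Jordan_Normal_Form.Gauss_Jordan_Elimination"
    "Jordan_Normal_Form.Determinant"
    "Jordan_Normal_Form.VS_Connect"
begin

text \<open>Indices are zero-based: the variables are \<open>x_0, ..., x_{d-1}\<close>, and a \<open>d\<close>-tuple of
  matrices is a function \<open>X :: nat \<Rightarrow> 'a mat\<close> of which only the values \<open>X k\<close> with \<open>k < d\<close> matter.\<close>

definition tuples :: "nat \<Rightarrow> nat \<Rightarrow> (nat \<Rightarrow> 'a mat) set" where
  "tuples d n = {X. \<forall>k<d. X k \<in> carrier_mat n n}"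

definition mat_prod :: "nat \<Rightarrow> 'a::semiring_1 mat list \<Rightarrow> 'a mat" where
  "mat_prod n Ms = foldr (*) Ms (1\<^sub>m n)"

definition mat_sum :: "nat \<Rightarrow> nat \<Rightarrow> ('i \<Rightarrow> 'a::comm_monoid_add mat) \<Rightarrow> 'i set \<Rightarrow> 'a mat" where
  "mat_sum nr nc f I = mat nr nc (\<lambda>(i, j). \<Sum>k\<in>I. f k $$ (i, j))"

definition kron :: "'a::times mat \<Rightarrow> 'a mat \<Rightarrow> 'a mat" where
  "kron A B = mat (dim_row A * dim_row B) (dim_col A * dim_col B)
     (\<lambda>(i, j). A $$ (i div dim_row B, j div dim_col B) * B $$ (i mod dim_row B, j mod dim_col B))"


section \<open>Noncommutative rational expressions\<close>

text \<open>A nc polynomial is a finitely supported function from words (lists of variable indices)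
  to coefficients.\<close>

type_synonym 'a nc_poly = "nat list \<Rightarrow>\<^sub>0 'a"

definition poly_eval :: "nat \<Rightarrow> (nat \<Rightarrow> 'a::field mat) \<Rightarrow> 'a nc_poly \<Rightarrow> 'a mat" where
  "poly_eval n X p = mat_sum n n (\<lambda>w. Poly_Mapping.lookup p w \<cdot>\<^sub>m mat_prod n (map X w)) (Poly_Mapping.keys p)"

datatype 'p rexp_over =
    Poly 'p
  | Add "'p rexp_over" "'p rexp_over"
  | Mult "'p rexp_over" "'p rexp_over"
  | Inv "'p rexp_over"

type_synonym 'a rexp = "'a nc_poly rexp_over"

primrec rexp_vars :: "'a::zero rexp \<Rightarrow> nat set" where
  "rexp_vars (Poly p) = (\<Union>w\<in>Poly_Mapping.keys p. set w)"
| "rexp_vars (Add P Q) = rexp_vars P \<union> rexp_vars Q"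
| "rexp_vars (Mult P Q) = rexp_vars P \<union> rexp_vars Q"
| "rexp_vars (Inv P) = rexp_vars P"

text \<open>\<open>None\<close> means that some inverse occurring in the expression does not exist at \<open>X\<close>.\<close>

primrec rexp_eval :: "nat \<Rightarrow> (nat \<Rightarrow> 'a::field mat) \<Rightarrow> 'a rexp \<Rightarrow> 'a mat option" where
  "rexp_eval n X (Poly p) = Some (poly_eval n X p)"
| "rexp_eval n X (Add P Q) =
     Option.bind (rexp_eval n X P) (\<lambda>M. Option.bind (rexp_eval n X Q) (\<lambda>N. Some (M + N)))"
| "rexp_eval n X (Mult P Q) =
     Option.bind (rexp_eval n X P) (\<lambda>M. Option.bind (rexp_eval n X Q) (\<lambda>N. Some (M * N)))"
| "rexp_eval n X (Inv P) = Option.bind (rexp_eval n X P) mat_inverse"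

definition rexp_dom :: "nat \<Rightarrow> nat \<Rightarrow> 'a::field rexp \<Rightarrow> (nat \<Rightarrow> 'a mat) set" where
  "rexp_dom d n R = {X \<in> tuples d n. rexp_eval n X R \<noteq> None}"


section \<open>Nc Fornasini--Marchesini realizations\<close>

definition linear_mat_map :: "nat \<Rightarrow> nat \<Rightarrow> nat \<Rightarrow> ('a::field mat \<Rightarrow> 'a mat) \<Rightarrow> bool" where
  "linear_mat_map s p q T \<longleftrightarrow>
     (\<forall>X\<in>carrier_mat s s. T X \<in> carrier_mat p q) \<and>
     (\<forall>X\<in>carrier_mat s s. \<forall>Y\<in>carrier_mat s s. T (X + Y) = T X + T Y) \<and>
     (\<forall>c. \<forall>X\<in>carrier_mat s s. T (c \<cdot>\<^sub>m X) = c \<cdot>\<^sub>m T X)"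

definition mat_block :: "nat \<Rightarrow> 'a mat \<Rightarrow> nat \<Rightarrow> nat \<Rightarrow> 'a mat" where
  "mat_block s X i j = mat s s (\<lambda>(a, b). X $$ (s * i + a, s * j + b))"

text \<open>The extension of \<open>T\<close>, mapping \<open>s \<times> s\<close> matrices to \<open>p \<times> q\<close> matrices, to
  \<open>sm \<times> sm\<close> matrices: \<open>T\<close> is applied to each \<open>s \<times> s\<close> block.\<close>

definition ext_map ::
    "nat \<Rightarrow> nat \<Rightarrow> nat \<Rightarrow> nat \<Rightarrow> ('a mat \<Rightarrow> 'a mat) \<Rightarrow> 'a mat \<Rightarrow> 'a mat" where
  "ext_map s p q m T X = mat (p * m) (q * m)
     (\<lambda>(a, b). T (mat_block s X (a div p) (b div q)) $$ (a mod p, b mod q))"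

record 'a fm_real =
  fm_dim :: nat
  fm_D :: "'a mat"
  fm_C :: "'a mat"
  fm_A :: "nat \<Rightarrow> 'a mat \<Rightarrow> 'a mat"
  fm_B :: "nat \<Rightarrow> 'a mat \<Rightarrow> 'a mat"

text \<open>Dimension \<open>0\<close> is allowed (an empty state space, where the realization is just
  \<open>I_m \<otimes> D\<close>). If dimensions had to be positive, a constant expression would have
  the minimal realization of dimension \<open>1\<close> with \<open>A = 0\<close>, \<open>B = 0\<close> and \<open>C = 0\<close>,
  which is neither controllable nor observable.\<close>

definition fm_realization :: "nat \<Rightarrow> nat \<Rightarrow> 'a::field fm_real \<Rightarrow> bool" where
  "fm_realization d s \<R> \<longleftrightarrow>
     fm_D \<R> \<in> carrier_mat s s \<and>
     fm_C \<R> \<in> carrier_mat s (fm_dim \<R>) \<and>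
     (\<forall>k<d. linear_mat_map s (fm_dim \<R>) (fm_dim \<R>) (fm_A \<R> k)) \<and>
     (\<forall>k<d. linear_mat_map s (fm_dim \<R>) s (fm_B \<R> k))"

definition fm_pencil ::
    "nat \<Rightarrow> nat \<Rightarrow> (nat \<Rightarrow> 'a::field mat) \<Rightarrow> 'a fm_real \<Rightarrow> nat \<Rightarrow> (nat \<Rightarrow> 'a mat) \<Rightarrow> 'a mat" where
  "fm_pencil d s Y \<R> m X = (let L = fm_dim \<R> in
     1\<^sub>m (L * m) - mat_sum (L * m) (L * m)
       (\<lambda>k. ext_map s L L m (fm_A \<R> k) (X k - kron (1\<^sub>m m) (Y k))) {..<d})"

definition fm_DOM ::
    "nat \<Rightarrow> nat \<Rightarrow> (nat \<Rightarrow> 'a::field mat) \<Rightarrow> 'a fm_real \<Rightarrow> nat \<Rightarrow> (nat \<Rightarrow> 'a mat) set" where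
  "fm_DOM d s Y \<R> m = {X \<in> tuples d (s * m). det (fm_pencil d s Y \<R> m X) \<noteq> 0}"

text \<open>Only meaningful for \<open>X \<in> fm_DOM d s Y \<R> m\<close>, where the inverse exists.\<close>

definition fm_eval ::
    "nat \<Rightarrow> nat \<Rightarrow> (nat \<Rightarrow> 'a::field mat) \<Rightarrow> 'a fm_real \<Rightarrow> nat \<Rightarrow> (nat \<Rightarrow> 'a mat) \<Rightarrow> 'a mat" where
  "fm_eval d s Y \<R> m X = (let L = fm_dim \<R> in
     kron (1\<^sub>m m) (fm_D \<R>) +
     kron (1\<^sub>m m) (fm_C \<R>) * the (mat_inverse (fm_pencil d s Y \<R> m X)) *
       mat_sum (L * m) (s * m)
         (\<lambda>k. ext_map s L s m (fm_B \<R> k) (X k - kron (1\<^sub>m m) (Y k))) {..<d})"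

definition fm_realizes ::
    "nat \<Rightarrow> nat \<Rightarrow> (nat \<Rightarrow> 'a::field mat) \<Rightarrow> 'a fm_real \<Rightarrow> 'a rexp \<Rightarrow> bool" where
  "fm_realizes d s Y \<R> R \<longleftrightarrow>
     fm_realization d s \<R> \<and>
     Y \<in> rexp_dom d s R \<and>
     (\<forall>m\<ge>1. rexp_dom d (s * m) R \<subseteq> fm_DOM d s Y \<R> m \<and>
        (\<forall>X\<in>rexp_dom d (s * m) R. rexp_eval (s * m) X R = Some (fm_eval d s Y \<R> m X)))"

definition fm_minimal ::
    "nat \<Rightarrow> nat \<Rightarrow> (nat \<Rightarrow> 'a::field mat) \<Rightarrow> 'a rexp \<Rightarrow> 'a fm_real \<Rightarrow> bool" where
  "fm_minimal d s Y R \<R> \<longleftrightarrow>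
     fm_realizes d s Y \<R> R \<and> (\<forall>\<R>'. fm_realizes d s Y \<R>' R \<longrightarrow> fm_dim \<R> \<le> fm_dim \<R>')"


section \<open>Controllability and observability\<close>

text \<open>A list \<open>[(i_1, X_1), ..., (i_l, X_l)]\<close> encodes the product of the \<open>A_{i_j}(X_j)\<close>.\<close>

definition fm_words :: "nat \<Rightarrow> nat \<Rightarrow> (nat \<times> 'a mat) list set" where
  "fm_words d s = lists ({..<d} \<times> carrier_mat s s)"

definition fm_A_word :: "'a::field fm_real \<Rightarrow> (nat \<times> 'a mat) list \<Rightarrow> 'a mat" where
  "fm_A_word \<R> ws = mat_prod (fm_dim \<R>) (map (\<lambda>(i, X). fm_A \<R> i X) ws)"

definition fm_controllable :: "nat \<Rightarrow> nat \<Rightarrow> 'a::field fm_real \<Rightarrow> bool" where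
  "fm_controllable d s \<R> \<longleftrightarrow>
     LinearCombinations.module.span class_ring (module_vec TYPE('a) (fm_dim \<R>))
       {(fm_A_word \<R> ws * fm_B \<R> k X) *\<^sub>v u | ws k X u.
          ws \<in> fm_words d s \<and> k < d \<and> X \<in> carrier_mat s s \<and> u \<in> carrier_vec s}
     = carrier_vec (fm_dim \<R>)"

definition fm_observable :: "nat \<Rightarrow> nat \<Rightarrow> 'a::field fm_real \<Rightarrow> bool" where
  "fm_observable d s \<R> \<longleftrightarrow>
     (\<forall>v\<in>carrier_vec (fm_dim \<R>).
        (\<forall>ws\<in>fm_words d s. (fm_C \<R> * fm_A_word \<R> ws) *\<^sub>v v = 0\<^sub>v s) \<longrightarrow> v = 0\<^sub>v (fm_dim \<R>))"

end

theory Submission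
  imports Defs
begin

text \<open>A linear map \<open>T\<close> intertwining the data of two realizations makes them agree wherever both are
  defined, and a one-sided inverse of \<open>T\<close> transfers the domain. Compressing to the controllable
  subspace, or dually to the annihilator of the unobservable one, therefore shrinks any realization
  that is not both controllable and observable.

  Conversely, \<open>dom R\<close> contains every block upper triangular tuple with diagonal \<open>I \<otimes> Y\<close>. Putting
  the letters of a word on the superdiagonal exhibits each moment \<open>C A_w B_k(X)\<close> as a block of the
  value of \<open>R\<close>, so all realizations of \<open>R\<close> have the same moments. The states indistinguishable by
  moments then define an injective map from the state space of a controllable and observable
  realization into that of any other one. No density argument is needed, so the field may be finite.\<close>

section \<open>Linear algebra\<close>

text \<open>A smaller realization must not only take the right values but be defined wherever
  \<open>R\<close> is, so invertibility of the pencil has to pass to it at every size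
  \<open>s * m\<close>. The direction of the morphism decides which one-sided inverse of
  \<open>T\<close> does this: a left inverse for the inclusion of a subspace, a right inverse for a
  projection.

  In the converse only values of \<open>R\<close> at matrices are available, and one moment has to
  be separated from all others. A superdiagonal shift turns the state equation into a recursion from
  the last block row upward, and since every letter has its own position, exactly one path leads
  from the first block to the last, even if letters repeat.

  The state spaces are compared by a linear relation because a state of the first realization may be
  matched by many states of the second, which is not assumed observable. Choosing partners for a
  basis turns the relation into a matrix, and its injectivity comes from observability of the first
  realization.\<close>

lemma injective_mat_dim_le:
  fixes M :: "'a::field mat"
  assumes M: "M \<in> carrier_mat p q"
    and inj: "\<And>v. v \<in> carrier_vec q \<Longrightarrow> M *\<^sub>v v = 0\<^sub>v p \<Longrightarrow> v = 0\<^sub>v q"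
  shows "q \<le> p"
proof (rule ccontr)
  assume "\<not> q \<le> p"
  then have pq: "p < q" by simp
  \<comment> \<open>Zero rows pad \<open>M\<close> to a square matrix whose kernel lies in that of
    \<open>M\<close>. Row \<open>p\<close> of \<open>M'\<close> is zero, so its transpose kills
    \<open>unit_vec q p\<close> and the determinant vanishes.\<close>
  define M' where "M' = mat q q (\<lambda>(i, j). if i < p then M $$ (i, j) else 0)"
  have M': "M' \<in> carrier_mat q q" by (simp add: M'_def)
  have Mv: "M *\<^sub>v v = 0\<^sub>v p" if v: "v \<in> carrier_vec q" and 0: "M' *\<^sub>v v = 0\<^sub>v q" for v
  proof (rule eq_vecI)
    fix i assume i: "i < dim_vec (0\<^sub>v p :: 'a vec)"
    have "row M i = row M' i" using i pq M by (auto simp: M'_def)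
    moreover have "(M' *\<^sub>v v) $ i = 0" using 0 i pq by simp
    ultimately show "(M *\<^sub>v v) $ i = 0\<^sub>v p $ i" using i pq M M' by simp
  qed (use M in simp)
  have "M'\<^sup>T *\<^sub>v unit_vec q p = 0\<^sub>v q"
    using pq by (intro eq_vecI) (auto simp: M'_def)
  then have "det (M'\<^sup>T) = 0"
    unfolding det_0_iff_vec_prod_zero_field[OF transpose_carrier_mat[THEN iffD2, OF M']]
    using unit_vec_nonzero[OF pq] by (intro exI[of _ "unit_vec q p"]) simp
  then have "det M' = 0" using det_transpose[OF M'] by simp
  then show False
    using det_0_iff_vec_prod_zero_field[OF M'] inj Mv by blast
qed

lemma left_inverse_dim_le:
  fixes P :: "'a::field mat"
  assumes P: "P \<in> carrier_mat n r" and Q: "Q \<in> carrier_mat r n" and QP: "Q * P = 1\<^sub>m r"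
  shows "r \<le> n"
proof (rule injective_mat_dim_le[OF P])
  fix v assume v: "v \<in> carrier_vec r" and 0: "P *\<^sub>v v = 0\<^sub>v n"
  have "v = (Q * P) *\<^sub>v v" using v by (simp add: QP)
  also have "\<dots> = Q *\<^sub>v (P *\<^sub>v v)" using v P Q by simp
  also have "\<dots> = 0\<^sub>v r" unfolding 0 using Q by (intro eq_vecI) auto
  finally show "v = 0\<^sub>v r" .
qed

text \<open>The pair with \<open>r\<close> maximal works: if \<open>P * Q\<close> moved some \<open>w \<in> W\<close>, then \<open>w - P * Q * w\<close>
  could be appended to \<open>P\<close> as a new column.\<close>

lemma subspace_parametrization:
  fixes W :: "'a::field vec set"
  assumes W: "W \<subseteq> carrier_vec n"
    and zero: "0\<^sub>v n \<in> W"
    and add: "\<And>x y. x \<in> W \<Longrightarrow> y \<in> W \<Longrightarrow> x + y \<in> W"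
    and smult: "\<And>c x. x \<in> W \<Longrightarrow> c \<cdot>\<^sub>v x \<in> W"
    and proper: "W \<noteq> carrier_vec n"
  obtains r P Q where "r < n" "P \<in> carrier_mat n r" "Q \<in> carrier_mat r n" "Q * P = 1\<^sub>m r"
    "\<And>v. v \<in> carrier_vec r \<Longrightarrow> P *\<^sub>v v \<in> W" "\<And>w. w \<in> W \<Longrightarrow> P *\<^sub>v (Q *\<^sub>v w) = w"
proof -
  define ok where "ok r \<longleftrightarrow> (\<exists>P Q. P \<in> carrier_mat n r \<and> Q \<in> carrier_mat r n \<and> Q * P = 1\<^sub>m r \<and>
    (\<forall>v\<in>carrier_vec r. P *\<^sub>v v \<in> W))" for r
  \<comment> \<open>The empty pair starts the maximisation. \<open>r = 0\<close> is a genuine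
    outcome, reached exactly when \<open>W\<close> is the zero subspace; the realization obtained
    from it then has an empty state space.\<close>
  have "ok 0"
    unfolding ok_def
  proof (intro exI conjI ballI)
    show "0\<^sub>m n 0 \<in> carrier_mat n 0" "0\<^sub>m 0 n \<in> carrier_mat 0 n" by auto
    show "0\<^sub>m 0 n * 0\<^sub>m n 0 = 1\<^sub>m 0" by auto
    fix v :: "'a vec" assume "v \<in> carrier_vec 0"
    then have "0\<^sub>m n 0 *\<^sub>v v = 0\<^sub>v n" by (intro eq_vecI) (auto simp: scalar_prod_def)
    then show "0\<^sub>m n 0 *\<^sub>v v \<in> W" using zero by simp
  qed
  moreover have bound: "\<forall>r. ok r \<longrightarrow> r \<le> n"
    unfolding ok_def using left_inverse_dim_le by blast
  ultimately obtain r where r: "ok r" and max: "\<And>k. ok k \<Longrightarrow> k \<le> r"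
    using Nat.ex_has_greatest_nat[of ok 0 n] by blast
  obtain P Q where P: "P \<in> carrier_mat n r" and Q: "Q \<in> carrier_mat r n" and QP: "Q * P = 1\<^sub>m r"
    and PW: "\<And>v. v \<in> carrier_vec r \<Longrightarrow> P *\<^sub>v v \<in> W"
    using r unfolding ok_def by blast
  have PQ: "P *\<^sub>v (Q *\<^sub>v w) = w" if w: "w \<in> W" for w
  proof (rule ccontr)
    assume ne: "P *\<^sub>v (Q *\<^sub>v w) \<noteq> w"
    have wn: "w \<in> carrier_vec n" using w W by blast
    have Qw: "Q *\<^sub>v w \<in> carrier_vec r" using Q wn by simp
    have PQw: "P *\<^sub>v (Q *\<^sub>v w) \<in> carrier_vec n" using P Qw by simp
    define x where "x = w + (-1) \<cdot>\<^sub>v (P *\<^sub>v (Q *\<^sub>v w))"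
    have xW: "x \<in> W" unfolding x_def by (intro add smult w PW Qw)
    then have xn: "x \<in> carrier_vec n" using W by blast
    have "Q *\<^sub>v x = Q *\<^sub>v w + (-1) \<cdot>\<^sub>v (Q *\<^sub>v (P *\<^sub>v (Q *\<^sub>v w)))"
      unfolding x_def using Q wn PQw
      by (simp add: mult_add_distrib_mat_vec mult_mat_vec)
    also have "Q *\<^sub>v (P *\<^sub>v (Q *\<^sub>v w)) = (Q * P) *\<^sub>v (Q *\<^sub>v w)"
      using Q P Qw by simp
    also have "\<dots> = Q *\<^sub>v w" using Qw by (simp add: QP)
    finally have Qx: "Q *\<^sub>v x = 0\<^sub>v r" using Q Qw by (auto intro!: eq_vecI)
    have "\<exists>i<n. x $ i \<noteq> 0"
    proof (rule ccontr)
      assume "\<not> ?thesis"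
      then have "P *\<^sub>v (Q *\<^sub>v w) = w"
        using wn PQw P by (intro eq_vecI) (auto simp: x_def)
      with ne show False by simp
    qed
    then obtain i where i: "i < n" and xi: "x $ i \<noteq> 0" by blast
    define e where "e = inverse (x $ i) \<cdot>\<^sub>v unit_vec n i"
    have en: "e \<in> carrier_vec n" by (simp add: e_def)
    have ex: "e \<bullet> x = 1" using i xi xn by (simp add: e_def)
    \<comment> \<open>\<open>e\<close> is only normalised at \<open>x\<close>. Subtracting its
      pullback along \<open>P * Q\<close> makes it vanish on the columns of \<open>P\<close>, and
      since \<open>Q *\<^sub>v x = 0\<close> its value at \<open>x\<close> stays 1. It becomes the
      new row of \<open>Q\<close>.\<close>
    define f where "f = e - (P * Q)\<^sup>T *\<^sub>v e"
    have PQ: "P * Q \<in> carrier_mat n n" using P Q by simp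
    have fn: "f \<in> carrier_vec n" using en PQ by (simp add: f_def)
    have f_scalar: "f \<bullet> y = e \<bullet> y - e \<bullet> (P *\<^sub>v (Q *\<^sub>v y))" if "y \<in> carrier_vec n" for y
    proof -
      have "f \<bullet> y = e \<bullet> y - ((P * Q)\<^sup>T *\<^sub>v e) \<bullet> y"
        unfolding f_def using en PQ that by (intro minus_scalar_prod_distrib) auto
      also have "((P * Q)\<^sup>T *\<^sub>v e) \<bullet> y = e \<bullet> ((P * Q) *\<^sub>v y)"
        using transpose_vec_mult_scalar[OF PQ that en] .
      also have "(P * Q) *\<^sub>v y = P *\<^sub>v (Q *\<^sub>v y)" using P Q that by simp
      finally show ?thesis .
    qed
    have "P *\<^sub>v 0\<^sub>v r = 0\<^sub>v n" using P by (intro eq_vecI) auto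
    then have fx: "f \<bullet> x = 1" using f_scalar[OF xn] ex Qx en by simp
    have fP: "f \<bullet> col P j = 0" if j: "j < r" for j
    proof -
      have c: "col P j \<in> carrier_vec n" using P by (simp add: carrier_vecI)
      have "Q *\<^sub>v col P j = col (Q * P) j" using P Q j by (intro eq_vecI) auto
      also have "\<dots> = unit_vec r j" unfolding QP using j by simp
      also have "P *\<^sub>v unit_vec r j = col P j" using P j by (intro eq_vecI) auto
      finally have "f \<bullet> col P j = e \<bullet> col P j - e \<bullet> col P j" unfolding f_scalar[OF c] by simp
      then show ?thesis by simp
    qed
    define P' where "P' = mat n (Suc r) (\<lambda>(i, j). if j < r then P $$ (i, j) else x $ i)"
    define Q' where "Q' = mat (Suc r) n (\<lambda>(i, j). if i < r then Q $$ (i, j) else f $ j)"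
    have rowQ': "row Q' i = (if i < r then row Q i else f)" if "i < Suc r" for i
      using that Q fn by (intro eq_vecI) (auto simp: Q'_def)
    have colP': "col P' j = (if j < r then col P j else x)" if "j < Suc r" for j
      using that P xn by (intro eq_vecI) (auto simp: P'_def)
    have P': "P' \<in> carrier_mat n (Suc r)" and Q': "Q' \<in> carrier_mat (Suc r) n"
      by (auto simp: P'_def Q'_def)
    have "Q' * P' = 1\<^sub>m (Suc r)"
    proof (rule eq_matI)
      fix i j assume "i < dim_row (1\<^sub>m (Suc r) :: 'a mat)" "j < dim_col (1\<^sub>m (Suc r) :: 'a mat)"
      then have i: "i < Suc r" and j: "j < Suc r" by auto
      have 1: "row Q i \<bullet> col P j = (if i = j then 1 else 0)" if "i < r" "j < r"
        using arg_cong[OF QP, of "\<lambda>M. M $$ (i, j)"] that P Q by simp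
      have 2: "row Q i \<bullet> x = 0" if "i < r"
        using arg_cong[OF Qx, of "\<lambda>v. v $ i"] that Q by simp
      show "(Q' * P') $$ (i, j) = 1\<^sub>m (Suc r) $$ (i, j)"
        using i j P' Q' 1 2 fx fP by (auto simp: rowQ' colP' less_Suc_eq)
    qed (use P' Q' in auto)
    moreover have "P' *\<^sub>v v \<in> W" if v: "v \<in> carrier_vec (Suc r)" for v
    proof -
      define u where "u = vec r (\<lambda>i. v $ i)"
      have u: "u \<in> carrier_vec r" by (simp add: u_def)
      have "P' *\<^sub>v v = P *\<^sub>v u + (v $ r) \<cdot>\<^sub>v x"
        using v P xn by (intro eq_vecI) (auto simp: P'_def u_def scalar_prod_def)
      then show ?thesis using add smult PW[OF u] xW by simp
    qed
    ultimately have "ok (Suc r)" unfolding ok_def using P' Q' by blast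
    with max show False by fastforce
  qed
  have "r < n"
  proof (rule ccontr)
    assume "\<not> r < n"
    then have rn: "r = n" using bound r by fastforce
    \<comment> \<open>For \<open>r = n\<close> the one-sided inverse is two-sided, so every
      \<open>w\<close> equals \<open>P *\<^sub>v (Q *\<^sub>v w)\<close> and lies in
      \<open>W\<close>, against properness.\<close>
    have "P * Q = 1\<^sub>m n" using mat_mult_left_right_inverse[of Q n P] P Q QP rn by simp
    moreover have "P *\<^sub>v (Q *\<^sub>v w) = (P * Q) *\<^sub>v w" if "w \<in> carrier_vec n" for w
      using P Q that by simp
    ultimately have "w \<in> W" if "w \<in> carrier_vec n" for w
      using PW[of "Q *\<^sub>v w"] Q that by simp
    with proper W show False by blast
  qed
  show thesis by (rule that[of r P Q]) (fact+)
qed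


section \<open>Block matrices\<close>

text \<open>A common form for \<open>ext_map\<close> and \<open>kron (1\<^sub>m m)\<close>: an
  \<open>m\<close> by \<open>m\<close> pattern with blocks of any shape covers states, inputs and
  outputs alike, and identities at size \<open>s * m\<close> reduce to identities between blocks
  whose size does not depend on \<open>m\<close>.\<close>

definition block_mat :: "nat \<Rightarrow> nat \<Rightarrow> nat \<Rightarrow> (nat \<Rightarrow> nat \<Rightarrow> 'a mat) \<Rightarrow> 'a mat" where
  "block_mat p q m f = mat (p * m) (q * m) (\<lambda>(a, b). f (a div p) (b div q) $$ (a mod p, b mod q))"

lemma block_mat_carrier [simp]: "block_mat p q m f \<in> carrier_mat (p * m) (q * m)"
  by (simp add: block_mat_def)

lemma block_mat_dim [simp]:
  "dim_row (block_mat p q m f) = p * m" "dim_col (block_mat p q m f) = q * m"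
  by (simp_all add: block_mat_def)

lemma block_index_less:
  fixes p :: nat
  assumes "i < m" "a < p"
  shows "p * i + a < p * m"
proof -
  have "p * i + a < p * Suc i" using assms by simp
  also have "\<dots> \<le> p * m" using assms by (intro mult_le_mono2) simp
  finally show ?thesis .
qed

lemma block_index_cases:
  fixes p :: nat
  assumes "x < p * m"
  obtains i a where "i < m" "a < p" "x = p * i + a"
proof
  have p: "p > 0" using assms by (cases p) auto
  show "x div p < m" using assms by (simp add: less_mult_imp_div_less mult.commute)
  show "x mod p < p" "x = p * (x div p) + x mod p" using p by simp_all
qed

lemma block_mat_index:
  assumes "i < m" "j < m" "a < p" "b < q"
  shows "block_mat p q m f $$ (p * i + a, q * j + b) = f i j $$ (a, b)"
  using assms by (simp add: block_mat_def block_index_less)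

lemma block_mat_eqI:
  assumes M: "M \<in> carrier_mat (p * m) (q * m)"
    and eq: "\<And>i j a b. i < m \<Longrightarrow> j < m \<Longrightarrow> a < p \<Longrightarrow> b < q \<Longrightarrow> M $$ (p * i + a, q * j + b) = f i j $$ (a, b)"
  shows "M = block_mat p q m f"
proof (rule eq_matI)
  fix x y assume "x < dim_row (block_mat p q m f)" "y < dim_col (block_mat p q m f)"
  then have "x < p * m" "y < q * m" by (auto simp: block_mat_def)
  then obtain i a j b where "i < m" "a < p" "x = p * i + a" "j < m" "b < q" "y = q * j + b"
    by (metis block_index_cases)
  then show "M $$ (x, y) = block_mat p q m f $$ (x, y)"
    by (simp add: eq block_mat_index)
qed (use M in \<open>auto simp: block_mat_def\<close>)

lemma block_mat_cong:
  assumes "\<And>i j. i < m \<Longrightarrow> j < m \<Longrightarrow> f i j = g i j"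
  shows "block_mat p q m f = block_mat p q m g"
  using assms by (intro block_mat_eqI) (auto simp: block_mat_index)

text \<open>\<open>block_mat\<close> reads only the entries in the \<open>p\<close> by
  \<open>q\<close> range, so a block can be recovered from it once its dimensions are known.\<close>

lemma block_mat_eqD:
  assumes eq: "block_mat p q m f = block_mat p q m g"
    and "f i j \<in> carrier_mat p q" "g i j \<in> carrier_mat p q" "i < m" "j < m"
  shows "f i j = g i j"
proof (rule eq_matI)
  fix a b assume "a < dim_row (g i j)" "b < dim_col (g i j)"
  with assms have "a < p" "b < q" by auto
  then show "f i j $$ (a, b) = g i j $$ (a, b)"
    using arg_cong[OF eq, of "\<lambda>M. M $$ (p * i + a, q * j + b)"] assms(4,5)
    by (simp only: block_mat_index)
qed (use assms(2,3) in auto)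

section \<open>Finite sums of matrices and arithmetic of block matrices\<close>

lemma mat_sum_carrier [simp]: "mat_sum p q f I \<in> carrier_mat p q"
  by (simp add: mat_sum_def)

lemma mat_sum_dim [simp]: "dim_row (mat_sum p q f I) = p" "dim_col (mat_sum p q f I) = q"
  by (simp_all add: mat_sum_def)

lemma mat_sum_index [simp]: "a < p \<Longrightarrow> b < q \<Longrightarrow> mat_sum p q f I $$ (a, b) = (\<Sum>k\<in>I. f k $$ (a, b))"
  by (simp add: mat_sum_def)

lemma mat_sum_cong:
  assumes "\<And>k. k \<in> I \<Longrightarrow> f k = g k"
  shows "mat_sum p q f I = mat_sum p q g I"
  using assms by (simp add: mat_sum_def)

lemma mat_sum_delta:
  assumes "finite I" "k \<in> I" "f k \<in> carrier_mat p q"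
    and "\<And>l. l \<in> I \<Longrightarrow> l \<noteq> k \<Longrightarrow> f l = 0\<^sub>m p q"
  shows "mat_sum p q f I = f k"
proof (rule eq_matI)
  fix a b assume "a < dim_row (f k)" "b < dim_col (f k)"
  then have ab: "a < p" "b < q" using assms(3) by auto
  have "(\<Sum>l\<in>I. f l $$ (a, b)) = (\<Sum>l\<in>I. if l = k then f k $$ (a, b) else 0)"
    using assms(4) ab by (intro sum.cong) auto
  then show "mat_sum p q f I $$ (a, b) = f k $$ (a, b)"
    using ab assms(1,2) by simp
qed (use assms(3) in auto)

lemma mat_sum_zero:
  assumes "\<And>l. l \<in> I \<Longrightarrow> f l = 0\<^sub>m p q"
  shows "mat_sum p q f I = 0\<^sub>m p q"
  using assms by (intro eq_matI) auto

lemma mult_mat_sum: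
  fixes P :: "'a::comm_semiring_0 mat"
  assumes P: "P \<in> carrier_mat p' p" and f: "\<And>k. k \<in> I \<Longrightarrow> f k \<in> carrier_mat p q"
  shows "P * mat_sum p q f I = mat_sum p' q (\<lambda>k. P * f k) I"
proof (rule eq_matI)
  fix a b assume "a < dim_row (mat_sum p' q (\<lambda>k. P * f k) I)" "b < dim_col (mat_sum p' q (\<lambda>k. P * f k) I)"
  then have ab: "a < p'" "b < q" by (auto simp: mat_sum_def)
  have "(P * mat_sum p q f I) $$ (a, b) = (\<Sum>c<p. \<Sum>k\<in>I. P $$ (a, c) * f k $$ (c, b))"
    using ab P by (simp add: mat_sum_def scalar_prod_def sum_distrib_left atLeast0LessThan)
  also have "\<dots> = (\<Sum>k\<in>I. \<Sum>c<p. P $$ (a, c) * f k $$ (c, b))" by (rule sum.swap)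
  also have "\<dots> = (\<Sum>k\<in>I. (P * f k) $$ (a, b))"
  proof (rule sum.cong)
    fix k assume "k \<in> I"
    with f have "f k \<in> carrier_mat p q" by blast
    then show "(\<Sum>c<p. P $$ (a, c) * f k $$ (c, b)) = (P * f k) $$ (a, b)"
      using ab P by (simp add: scalar_prod_def atLeast0LessThan)
  qed simp
  finally show "(P * mat_sum p q f I) $$ (a, b) = mat_sum p' q (\<lambda>k. P * f k) I $$ (a, b)"
    using ab by simp
qed (use P in \<open>auto simp: mat_sum_def\<close>)

lemma mat_sum_mult:
  fixes P :: "'a::comm_semiring_0 mat"
  assumes P: "P \<in> carrier_mat q q'" and f: "\<And>k. k \<in> I \<Longrightarrow> f k \<in> carrier_mat p q"
  shows "mat_sum p q f I * P = mat_sum p q' (\<lambda>k. f k * P) I"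
proof (rule eq_matI)
  fix a b assume "a < dim_row (mat_sum p q' (\<lambda>k. f k * P) I)" "b < dim_col (mat_sum p q' (\<lambda>k. f k * P) I)"
  then have ab: "a < p" "b < q'" by (auto simp: mat_sum_def)
  have "(mat_sum p q f I * P) $$ (a, b) = (\<Sum>c<q. \<Sum>k\<in>I. f k $$ (a, c) * P $$ (c, b))"
    using ab P by (simp add: mat_sum_def scalar_prod_def sum_distrib_right atLeast0LessThan)
  also have "\<dots> = (\<Sum>k\<in>I. \<Sum>c<q. f k $$ (a, c) * P $$ (c, b))" by (rule sum.swap)
  also have "\<dots> = (\<Sum>k\<in>I. (f k * P) $$ (a, b))"
  proof (rule sum.cong)
    fix k assume "k \<in> I"
    with f have "f k \<in> carrier_mat p q" by blast
    then show "(\<Sum>c<q. f k $$ (a, c) * P $$ (c, b)) = (f k * P) $$ (a, b)"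
      using ab P by (simp add: scalar_prod_def atLeast0LessThan)
  qed simp
  finally show "(mat_sum p q f I * P) $$ (a, b) = mat_sum p q' (\<lambda>k. f k * P) I $$ (a, b)"
    using ab by simp
qed (use P in \<open>auto simp: mat_sum_def\<close>)

lemma sum_block_index:
  fixes f :: "nat \<Rightarrow> 'a::comm_monoid_add"
  shows "(\<Sum>x<p * m. f x) = (\<Sum>i<m. \<Sum>a<p. f (p * i + a))"
proof -
  have "sum f {i * p..<i * p + p} = (\<Sum>a<p. f (p * i + a))" for i
    using sum.shift_bounds_nat_ivl[of f 0 "i * p" p]
    by (simp only: add_0 atLeast0LessThan add.commute mult.commute)
  then show ?thesis by (simp only: sum.nat_group[symmetric] mult.commute[of p m])
qed

lemma block_mat_mult:
  fixes f g :: "nat \<Rightarrow> nat \<Rightarrow> 'a::comm_semiring_0 mat"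
  assumes f: "\<And>i j. i < m \<Longrightarrow> j < m \<Longrightarrow> f i j \<in> carrier_mat p q"
    and g: "\<And>i j. i < m \<Longrightarrow> j < m \<Longrightarrow> g i j \<in> carrier_mat q r"
  shows "block_mat p q m f * block_mat q r m g =
    block_mat p r m (\<lambda>i j. mat_sum p r (\<lambda>l. f i l * g l j) {..<m})"
proof (rule block_mat_eqI)
  fix i j a b assume ij: "i < m" "j < m" and ab: "a < p" "b < r"
  have "(block_mat p q m f * block_mat q r m g) $$ (p * i + a, r * j + b) =
    (\<Sum>x<q * m. block_mat p q m f $$ (p * i + a, x) * block_mat q r m g $$ (x, r * j + b))"
    using ij ab
    by (simp add: scalar_prod_def block_index_less atLeast0LessThan)
  also have "\<dots> = (\<Sum>l<m. \<Sum>c<q. f i l $$ (a, c) * g l j $$ (c, b))"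
    unfolding sum_block_index using ij ab by (simp add: block_mat_index)
  also have "\<dots> = (\<Sum>l<m. (f i l * g l j) $$ (a, b))"
  proof (rule sum.cong)
    fix l assume "l \<in> {..<m}"
    then show "(\<Sum>c<q. f i l $$ (a, c) * g l j $$ (c, b)) = (f i l * g l j) $$ (a, b)"
      using ab f[of i l] g[of l j] ij by (simp add: scalar_prod_def atLeast0LessThan)
  qed simp
  finally show "(block_mat p q m f * block_mat q r m g) $$ (p * i + a, r * j + b) =
      mat_sum p r (\<lambda>l. f i l * g l j) {..<m} $$ (a, b)"
    using ab by simp
qed (auto intro!: carrier_matI)

lemma block_mat_add:
  assumes "\<And>i j. i < m \<Longrightarrow> j < m \<Longrightarrow> g i j \<in> carrier_mat p q"
  shows "block_mat p q m f + block_mat p q m g = block_mat p q m (\<lambda>i j. f i j + g i j)"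
  using assms
  by (intro block_mat_eqI) (auto simp: block_mat_index block_index_less carrier_matD[OF assms])

lemma block_mat_minus:
  assumes "\<And>i j. i < m \<Longrightarrow> j < m \<Longrightarrow> g i j \<in> carrier_mat p q"
  shows "block_mat p q m f - block_mat p q m g = block_mat p q m (\<lambda>i j. f i j - g i j)"
  using assms
  by (intro block_mat_eqI) (auto simp: block_mat_index block_index_less carrier_matD[OF assms])

lemma block_mat_mat_sum:
  "mat_sum (p * m) (q * m) (\<lambda>k. block_mat p q m (f k)) I = block_mat p q m (\<lambda>i j. mat_sum p q (\<lambda>k. f k i j) I)"
  by (intro block_mat_eqI) (auto simp: block_mat_index block_index_less)

lemma kron_one_block_mat:
  fixes P :: "'a::semiring_1 mat"
  assumes P: "P \<in> carrier_mat p q"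
  shows "kron (1\<^sub>m m) P = block_mat p q m (\<lambda>i j. if i = j then P else 0\<^sub>m p q)"
proof (rule block_mat_eqI)
  show "kron (1\<^sub>m m) P \<in> carrier_mat (p * m) (q * m)" using P by (simp add: kron_def mult.commute)
  fix i j a b assume "i < m" "j < m" "a < p" "b < q"
  then show "kron (1\<^sub>m m) P $$ (p * i + a, q * j + b) = (if i = j then P else 0\<^sub>m p q) $$ (a, b)"
    using P block_index_less[of i m a p] block_index_less[of j m b q]
    by (auto simp: kron_def mult.commute[of m])
qed

lemma one_block_mat: "1\<^sub>m (p * m) = block_mat p p m (\<lambda>i j. if i = j then 1\<^sub>m p else 0\<^sub>m p p)"
proof (rule block_mat_eqI)
  fix i j a b assume *: "i < m" "j < m" "a < p" "b < p"
  have "p * i + a = p * j + b \<longleftrightarrow> i = j \<and> a = b"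
  proof
    assume eq: "p * i + a = p * j + b"
    have "i = (p * i + a) div p" "a = (p * i + a) mod p" using * by simp_all
    moreover have "j = (p * j + b) div p" "b = (p * j + b) mod p" using * by simp_all
    ultimately show "i = j \<and> a = b" using eq by metis
  qed simp
  then show "1\<^sub>m (p * m) $$ (p * i + a, p * j + b) = (if i = j then 1\<^sub>m p else 0\<^sub>m p p) $$ (a, b)"
    using * by (simp add: block_index_less)
qed simp

lemma ext_map_block_mat: "ext_map s p q m T X = block_mat p q m (\<lambda>i j. T (mat_block s X i j))"
  by (simp add: ext_map_def block_mat_def)

lemma mat_block_carrier [simp]: "mat_block s X i j \<in> carrier_mat s s"
  by (simp add: mat_block_def)

lemma block_mat_mat_block:
  "M \<in> carrier_mat (s * m) (s * m) \<Longrightarrow> block_mat s s m (mat_block s M) = M"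
  by (rule block_mat_eqI[symmetric]) (auto simp: mat_block_def)

lemma mat_block_block_mat:
  assumes "i < m" "j < m" "f i j \<in> carrier_mat s s"
  shows "mat_block s (block_mat s s m f) i j = f i j"
  using assms by (intro eq_matI) (auto simp: mat_block_def block_mat_index)

text \<open>The left factor is block diagonal, so only \<open>l = i\<close> survives in the block
  product. Together with the mirror image below this lifts an intertwining relation between state
  maps to the pencils at every size.\<close>

lemma kron_one_mult_block_mat:
  fixes P :: "'a::comm_semiring_1 mat"
  assumes P: "P \<in> carrier_mat p' p" and f: "\<And>i j. i < m \<Longrightarrow> j < m \<Longrightarrow> f i j \<in> carrier_mat p q"
  shows "kron (1\<^sub>m m) P * block_mat p q m f = block_mat p' q m (\<lambda>i j. P * f i j)"
proof -
  have "kron (1\<^sub>m m) P * block_mat p q m f =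
    block_mat p' q m (\<lambda>i j. mat_sum p' q (\<lambda>l. (if i = l then P else 0\<^sub>m p' p) * f l j) {..<m})"
    unfolding kron_one_block_mat[OF P] using P f by (intro block_mat_mult) auto
  also have "\<dots> = block_mat p' q m (\<lambda>i j. P * f i j)"
  proof (rule block_mat_cong)
    fix i j assume "i < m" "j < m"
    then show "mat_sum p' q (\<lambda>l. (if i = l then P else 0\<^sub>m p' p) * f l j) {..<m} = P * f i j"
      using P f by (subst mat_sum_delta[where k = i]) (auto simp: left_mult_zero_mat[OF f])
  qed
  finally show ?thesis .
qed

lemma block_mat_mult_kron_one:
  fixes P :: "'a::comm_semiring_1 mat"
  assumes P: "P \<in> carrier_mat q q'" and f: "\<And>i j. i < m \<Longrightarrow> j < m \<Longrightarrow> f i j \<in> carrier_mat p q"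
  shows "block_mat p q m f * kron (1\<^sub>m m) P = block_mat p q' m (\<lambda>i j. f i j * P)"
proof -
  have "block_mat p q m f * kron (1\<^sub>m m) P =
    block_mat p q' m (\<lambda>i j. mat_sum p q' (\<lambda>l. f i l * (if l = j then P else 0\<^sub>m q q')) {..<m})"
    unfolding kron_one_block_mat[OF P] using P f by (intro block_mat_mult) auto
  also have "\<dots> = block_mat p q' m (\<lambda>i j. f i j * P)"
  proof (rule block_mat_cong)
    fix i j assume "i < m" "j < m"
    then show "mat_sum p q' (\<lambda>l. f i l * (if l = j then P else 0\<^sub>m q q')) {..<m} = f i j * P"
      using P f by (subst mat_sum_delta[where k = j]) (auto simp: right_mult_zero_mat[OF f] intro!: mult_carrier_mat[of _ p q])
  qed
  finally show ?thesis .
qed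

lemma kron_one_mult:
  fixes P :: "'a::comm_semiring_1 mat"
  assumes P: "P \<in> carrier_mat p q" and Q: "Q \<in> carrier_mat q r"
  shows "kron (1\<^sub>m m) P * kron (1\<^sub>m m) Q = kron (1\<^sub>m m) (P * Q)"
  unfolding kron_one_block_mat[OF Q] kron_one_block_mat[OF mult_carrier_mat[OF P Q]]
  using P Q by (subst kron_one_mult_block_mat[OF P]) (auto intro!: block_mat_cong)

lemma kron_one_one: "kron (1\<^sub>m m) (1\<^sub>m p) = (1\<^sub>m (p * m) :: 'a::semiring_1 mat)"
  by (simp add: kron_one_block_mat[OF one_carrier_mat] one_block_mat)

lemma kron_one_carrier: "P \<in> carrier_mat p q \<Longrightarrow> kron (1\<^sub>m m) P \<in> carrier_mat (p * m) (q * m)"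
  by (simp add: kron_def mult.commute)


section \<open>Morphisms of realizations\<close>

lemma mat_eq_mult_vecI:
  fixes M N :: "'a::semiring_1 mat"
  assumes M: "M \<in> carrier_mat p q" and N: "N \<in> carrier_mat p q"
    and eq: "\<And>v. v \<in> carrier_vec q \<Longrightarrow> M *\<^sub>v v = N *\<^sub>v v"
  shows "M = N"
proof (rule eq_matI)
  fix i j assume "i < dim_row N" "j < dim_col N"
  then have ij: "i < p" "j < q" using N by auto
  have "(M *\<^sub>v unit_vec q j) $ i = (N *\<^sub>v unit_vec q j) $ i" by (simp add: eq)
  then show "M $$ (i, j) = N $$ (i, j)" using ij M N by simp
qed (use M N in auto)

text \<open>Serves as the induction principle for spans: \<open>N\<close> is taken to be the set of
  all vectors with the property to be shown.\<close>

lemma span_vec_least: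
  fixes S N :: "'a::field vec set"
  assumes "S \<subseteq> N" "N \<subseteq> carrier_vec n" "0\<^sub>v n \<in> N"
    and "\<And>x y. x \<in> N \<Longrightarrow> y \<in> N \<Longrightarrow> x + y \<in> N"
    and "\<And>c x. x \<in> N \<Longrightarrow> c \<cdot>\<^sub>v x \<in> N"
  shows "LinearCombinations.module.span class_ring (module_vec TYPE('a) n) S \<subseteq> N"
proof -
  interpret vec_space "TYPE('a)" n .
  have "submodule class_ring N V"
    using assms vec_vs[THEN vectorspace.axioms(1)] unfolding submodule_def by (auto simp: module_vec_simps class_ring_simps)
  then show ?thesis by (rule span_is_subset[OF assms(1)])
qed

lemma span_vec_closed:
  fixes S :: "'a::field vec set"
  assumes S: "S \<subseteq> carrier_vec n"
  defines "W \<equiv> LinearCombinations.module.span class_ring (module_vec TYPE('a) n) S"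
  shows "S \<subseteq> W" "W \<subseteq> carrier_vec n" "0\<^sub>v n \<in> W"
    "\<And>x y. x \<in> W \<Longrightarrow> y \<in> W \<Longrightarrow> x + y \<in> W" "\<And>c x. x \<in> W \<Longrightarrow> c \<cdot>\<^sub>v x \<in> W"
proof -
  interpret vec_space "TYPE('a)" n .
  have "submodule class_ring (span S) V" using S by (intro span_is_submodule) (simp add: module_vec_simps)
  then show "W \<subseteq> carrier_vec n" "0\<^sub>v n \<in> W"
    "\<And>x y. x \<in> W \<Longrightarrow> y \<in> W \<Longrightarrow> x + y \<in> W" "\<And>c x. x \<in> W \<Longrightarrow> c \<cdot>\<^sub>v x \<in> W"
    unfolding W_def submodule_def by (auto simp: module_vec_simps)
  show "S \<subseteq> W" unfolding W_def using S by (intro in_own_span) simp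
qed

text \<open>The \<open>(i, j)\<close> block of the sum of the extended \<open>A_k\<close> at
  \<open>Z\<close>. In use, \<open>Z\<close> is the shift of \<open>X\<close> by
  \<open>kron (1\<^sub>m m) (Y k)\<close>, and the pencil is the identity minus the block matrix of
  these.\<close>

definition fm_state :: "nat \<Rightarrow> nat \<Rightarrow> 'a::field fm_real \<Rightarrow> (nat \<Rightarrow> 'a mat) \<Rightarrow> nat \<Rightarrow> nat \<Rightarrow> 'a mat" where
  "fm_state d s \<R> Z i j = mat_sum (fm_dim \<R>) (fm_dim \<R>) (\<lambda>k. fm_A \<R> k (mat_block s (Z k) i j)) {..<d}"

definition fm_input :: "nat \<Rightarrow> nat \<Rightarrow> 'a::field fm_real \<Rightarrow> (nat \<Rightarrow> 'a mat) \<Rightarrow> nat \<Rightarrow> nat \<Rightarrow> 'a mat" where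
  "fm_input d s \<R> Z i j = mat_sum (fm_dim \<R>) s (\<lambda>k. fm_B \<R> k (mat_block s (Z k) i j)) {..<d}"

lemma fm_state_carrier [simp]: "fm_state d s \<R> Z i j \<in> carrier_mat (fm_dim \<R>) (fm_dim \<R>)"
  and fm_input_carrier [simp]: "fm_input d s \<R> Z i j \<in> carrier_mat (fm_dim \<R>) s"
  by (simp_all add: fm_state_def fm_input_def)

section \<open>The state equation of a realization\<close>

lemma fm_realizationD:
  assumes "fm_realization d s \<R>"
  shows "fm_D \<R> \<in> carrier_mat s s" "fm_C \<R> \<in> carrier_mat s (fm_dim \<R>)"
    "\<And>k X. k < d \<Longrightarrow> X \<in> carrier_mat s s \<Longrightarrow> fm_A \<R> k X \<in> carrier_mat (fm_dim \<R>) (fm_dim \<R>)"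
    "\<And>k X. k < d \<Longrightarrow> X \<in> carrier_mat s s \<Longrightarrow> fm_B \<R> k X \<in> carrier_mat (fm_dim \<R>) s"
  using assms unfolding fm_realization_def linear_mat_map_def by auto

lemma fm_pencil_block_mat:
  "fm_pencil d s Y \<R> m X = 1\<^sub>m (fm_dim \<R> * m) -
    block_mat (fm_dim \<R>) (fm_dim \<R>) m (fm_state d s \<R> (\<lambda>k. X k - kron (1\<^sub>m m) (Y k)))"
  by (simp add: fm_pencil_def Let_def ext_map_block_mat block_mat_mat_sum fm_state_def[abs_def])

lemma fm_pencil_carrier: "fm_pencil d s Y \<R> m X \<in> carrier_mat (fm_dim \<R> * m) (fm_dim \<R> * m)"
  unfolding fm_pencil_block_mat by (rule minus_carrier_mat) simp

lemma mat_inverse_det: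
  fixes M :: "'a::field mat"
  assumes M: "M \<in> carrier_mat n n" and det: "det M \<noteq> 0"
  obtains G where "mat_inverse M = Some G" "G \<in> carrier_mat n n" "M * G = 1\<^sub>m n" "G * M = 1\<^sub>m n"
proof -
  obtain G where "mat_inverse M = Some G"
    using mat_inverse(1)[OF M] det_non_zero_imp_unit[OF M det] by fastforce
  with mat_inverse(2)[OF M this] that show thesis by blast
qed

lemma det_nonzeroI:
  fixes M :: "'a::field mat"
  assumes "M \<in> carrier_mat n n" "G \<in> carrier_mat n n" "M * G = 1\<^sub>m n"
  shows "det M \<noteq> 0"
  using det_mult[OF assms(1,2)] assms(3) by auto

text \<open>The inverse inside \<open>fm_eval\<close> is traded for a solution \<open>V\<close> of a
  linear equation: such an equation can be multiplied by an intertwining matrix or split into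
  blocks, an explicit inverse cannot.\<close>

lemma fm_eval_solution:
  assumes X: "X \<in> fm_DOM d s Y \<R> m" and \<R>: "fm_realization d s \<R>"
  obtains V where "V \<in> carrier_mat (fm_dim \<R> * m) (s * m)"
    "fm_pencil d s Y \<R> m X * V = block_mat (fm_dim \<R>) s m (fm_input d s \<R> (\<lambda>k. X k - kron (1\<^sub>m m) (Y k)))"
    "fm_eval d s Y \<R> m X = kron (1\<^sub>m m) (fm_D \<R>) + kron (1\<^sub>m m) (fm_C \<R>) * V"
proof -
  define L where "L = fm_dim \<R>"
  let ?M = "fm_pencil d s Y \<R> m X"
  let ?B = "block_mat L s m (fm_input d s \<R> (\<lambda>k. X k - kron (1\<^sub>m m) (Y k)))"
  have M: "?M \<in> carrier_mat (L * m) (L * m)" unfolding L_def by (rule fm_pencil_carrier)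
  obtain G where G: "mat_inverse ?M = Some G" "G \<in> carrier_mat (L * m) (L * m)" "?M * G = 1\<^sub>m (L * m)"
    using mat_inverse_det[OF M] X unfolding fm_DOM_def by blast
  have C: "kron (1\<^sub>m m) (fm_C \<R>) \<in> carrier_mat (s * m) (L * m)"
    using fm_realizationD(2)[OF \<R>] unfolding L_def by (rule kron_one_carrier)
  have "?M * (G * ?B) = ?M * G * ?B"
    using M G(2) by (intro assoc_mult_mat[symmetric]) auto
  then have "?M * (G * ?B) = ?B" by (simp add: G(3))
  moreover have "kron (1\<^sub>m m) (fm_C \<R>) * G * ?B = kron (1\<^sub>m m) (fm_C \<R>) * (G * ?B)"
    using C G(2) by (intro assoc_mult_mat) auto
  then have "fm_eval d s Y \<R> m X = kron (1\<^sub>m m) (fm_D \<R>) + kron (1\<^sub>m m) (fm_C \<R>) * (G * ?B)"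
    by (simp add: fm_eval_def Let_def G(1) ext_map_block_mat block_mat_mat_sum fm_input_def[abs_def] L_def)
  moreover have "G * ?B \<in> carrier_mat (L * m) (s * m)" using G(2) by (intro mult_carrier_mat) auto
  ultimately show thesis using that unfolding L_def by blast
qed

lemma fm_solution_unique:
  assumes X: "X \<in> fm_DOM d s Y \<R> m"
    and "V \<in> carrier_mat (fm_dim \<R> * m) q" "W \<in> carrier_mat (fm_dim \<R> * m) q"
    and eq: "fm_pencil d s Y \<R> m X * V = fm_pencil d s Y \<R> m X * W"
  shows "V = W"
proof -
  let ?n = "fm_dim \<R> * m"
  let ?M = "fm_pencil d s Y \<R> m X"
  note M = fm_pencil_carrier[of d s Y \<R> m X]
  obtain G where G: "G \<in> carrier_mat ?n ?n" "G * ?M = 1\<^sub>m ?n"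
    using mat_inverse_det[OF M] X unfolding fm_DOM_def by blast
  have "G * (?M * U) = U" if "U \<in> carrier_mat ?n q" for U
    using assoc_mult_mat[OF G(1) M that] G(2) that by simp
  with eq assms(2,3) show ?thesis by metis
qed

text \<open>\<open>T\<close> sends states of \<open>\<R>1\<close> to states of \<open>\<R>2\<close>
  and may be rectangular. The inclusion of the controllable subspace and the projection along the
  unobservable subspace are both instances, with the given realization at opposite ends of the
  arrow.\<close>

locale fm_morphism =
  fixes d s :: nat and \<R>1 \<R>2 :: "'a::field fm_real" and T :: "'a mat"
  assumes R1: "fm_realization d s \<R>1" and R2: "fm_realization d s \<R>2"
    and T: "T \<in> carrier_mat (fm_dim \<R>2) (fm_dim \<R>1)"
    and TA: "\<And>k X. k < d \<Longrightarrow> X \<in> carrier_mat s s \<Longrightarrow> T * fm_A \<R>1 k X = fm_A \<R>2 k X * T"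
    and TB: "\<And>k X. k < d \<Longrightarrow> X \<in> carrier_mat s s \<Longrightarrow> T * fm_B \<R>1 k X = fm_B \<R>2 k X"
    and CT: "fm_C \<R>2 * T = fm_C \<R>1"
    and DD: "fm_D \<R>2 = fm_D \<R>1"
begin

lemma kron_carrier: "kron (1\<^sub>m m) T \<in> carrier_mat (fm_dim \<R>2 * m) (fm_dim \<R>1 * m)"
  by (rule kron_one_carrier[OF T])

lemma pencil_intertwine:
  "kron (1\<^sub>m m) T * fm_pencil d s Y \<R>1 m X = fm_pencil d s Y \<R>2 m X * kron (1\<^sub>m m) T"
proof -
  define Z where "Z = (\<lambda>k. X k - kron (1\<^sub>m m) (Y k))"
  have "T * fm_state d s \<R>1 Z i j = fm_state d s \<R>2 Z i j * T" for i j
    unfolding fm_state_def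
    by (subst mult_mat_sum[OF T], use fm_realizationD(3)[OF R1] in simp,
        subst mat_sum_mult[OF T], use fm_realizationD(3)[OF R2] in simp)
      (rule mat_sum_cong, simp add: TA)
  then have "kron (1\<^sub>m m) T * block_mat (fm_dim \<R>1) (fm_dim \<R>1) m (fm_state d s \<R>1 Z) =
    block_mat (fm_dim \<R>2) (fm_dim \<R>2) m (fm_state d s \<R>2 Z) * kron (1\<^sub>m m) T"
    by (simp add: kron_one_mult_block_mat[OF T] block_mat_mult_kron_one[OF T])
  then show ?thesis
    unfolding fm_pencil_block_mat Z_def[symmetric]
    using kron_carrier[of m] mult_minus_distrib_mat[OF kron_carrier[of m] one_carrier_mat block_mat_carrier]
      minus_mult_distrib_mat[OF one_carrier_mat block_mat_carrier kron_carrier[of m]]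
    by simp
qed

text \<open>The lifted \<open>T\<close> carries the solution of the first state equation to a
  solution of the second; uniqueness identifies it with \<open>W\<close>, and \<open>CT\<close>
  matches the outputs. Membership in both domains is assumed, since transferring it takes a
  one-sided inverse of \<open>T\<close>.\<close>

lemma eval_eq:
  assumes X1: "X \<in> fm_DOM d s Y \<R>1 m" and X2: "X \<in> fm_DOM d s Y \<R>2 m"
  shows "fm_eval d s Y \<R>1 m X = fm_eval d s Y \<R>2 m X"
proof -
  define Z where "Z = (\<lambda>k. X k - kron (1\<^sub>m m) (Y k))"
  let ?K = "kron (1\<^sub>m m) T"
  obtain V where V: "V \<in> carrier_mat (fm_dim \<R>1 * m) (s * m)"
    "fm_pencil d s Y \<R>1 m X * V = block_mat (fm_dim \<R>1) s m (fm_input d s \<R>1 Z)"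
    "fm_eval d s Y \<R>1 m X = kron (1\<^sub>m m) (fm_D \<R>1) + kron (1\<^sub>m m) (fm_C \<R>1) * V"
    unfolding Z_def by (rule fm_eval_solution[OF X1 R1])
  obtain W where W: "W \<in> carrier_mat (fm_dim \<R>2 * m) (s * m)"
    "fm_pencil d s Y \<R>2 m X * W = block_mat (fm_dim \<R>2) s m (fm_input d s \<R>2 Z)"
    "fm_eval d s Y \<R>2 m X = kron (1\<^sub>m m) (fm_D \<R>2) + kron (1\<^sub>m m) (fm_C \<R>2) * W"
    unfolding Z_def by (rule fm_eval_solution[OF X2 R2])
  have input: "T * fm_input d s \<R>1 Z i j = fm_input d s \<R>2 Z i j" for i j
    unfolding fm_input_def
    by (subst mult_mat_sum[OF T], use fm_realizationD(4)[OF R1] in simp)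
      (rule mat_sum_cong, simp add: TB)
  have "fm_pencil d s Y \<R>2 m X * (?K * V) = (fm_pencil d s Y \<R>2 m X * ?K) * V"
    by (rule assoc_mult_mat[OF fm_pencil_carrier kron_carrier V(1), symmetric])
  also have "\<dots> = ?K * (fm_pencil d s Y \<R>1 m X * V)"
    unfolding pencil_intertwine[symmetric] by (rule assoc_mult_mat[OF kron_carrier fm_pencil_carrier V(1)])
  also have "\<dots> = block_mat (fm_dim \<R>2) s m (fm_input d s \<R>2 Z)"
    unfolding V(2) by (subst kron_one_mult_block_mat[OF T]) (simp_all add: input)
  also have "\<dots> = fm_pencil d s Y \<R>2 m X * W" by (simp add: W(2))
  finally have "?K * V = W"
    by (rule fm_solution_unique[OF X2 mult_carrier_mat[OF kron_carrier V(1)] W(1)])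
  then have "kron (1\<^sub>m m) (fm_C \<R>2) * W = (kron (1\<^sub>m m) (fm_C \<R>2) * ?K) * V"
    using assoc_mult_mat[OF kron_one_carrier[OF fm_realizationD(2)[OF R2]] kron_carrier V(1)] by metis
  also have "kron (1\<^sub>m m) (fm_C \<R>2) * ?K = kron (1\<^sub>m m) (fm_C \<R>1)"
    using kron_one_mult[OF fm_realizationD(2)[OF R2] T] CT by simp
  finally show ?thesis using V(3) W(3) DD by simp
qed

text \<open>With \<open>G\<close> the inverse of the first pencil, \<open>?K * (G * ?H)\<close> is a
  right inverse of the second: intertwining moves \<open>?K\<close> to the left, \<open>G\<close>
  cancels, and \<open>T * S = 1\<close> finishes.\<close>

lemma DOM_forward:
  assumes S: "S \<in> carrier_mat (fm_dim \<R>1) (fm_dim \<R>2)" "T * S = 1\<^sub>m (fm_dim \<R>2)"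
    and X: "X \<in> fm_DOM d s Y \<R>1 m"
  shows "X \<in> fm_DOM d s Y \<R>2 m"
proof -
  let ?K = "kron (1\<^sub>m m) T" and ?H = "kron (1\<^sub>m m) S"
  let ?M1 = "fm_pencil d s Y \<R>1 m X" and ?M2 = "fm_pencil d s Y \<R>2 m X"
  let ?n1 = "fm_dim \<R>1 * m" and ?n2 = "fm_dim \<R>2 * m"
  have H: "?H \<in> carrier_mat ?n1 ?n2" by (rule kron_one_carrier[OF S(1)])
  note K = kron_carrier[of m]
  obtain G where G: "G \<in> carrier_mat ?n1 ?n1" "?M1 * G = 1\<^sub>m ?n1"
    using mat_inverse_det[OF fm_pencil_carrier] X unfolding fm_DOM_def by blast
  have GH: "G * ?H \<in> carrier_mat ?n1 ?n2" by (rule mult_carrier_mat[OF G(1) H])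
  have "?M2 * (?K * (G * ?H)) = ?M2 * ?K * (G * ?H)"
    by (rule assoc_mult_mat[OF fm_pencil_carrier K GH, symmetric])
  also have "\<dots> = ?K * (?M1 * (G * ?H))"
    unfolding pencil_intertwine[symmetric] by (rule assoc_mult_mat[OF K fm_pencil_carrier GH])
  also have "?M1 * (G * ?H) = ?H"
    using assoc_mult_mat[OF fm_pencil_carrier G(1) H, symmetric] G(2) H by simp
  also have "?K * ?H = 1\<^sub>m ?n2" by (simp add: kron_one_mult[OF T S(1)] S(2) kron_one_one)
  finally have "det ?M2 \<noteq> 0"
    by (intro det_nonzeroI[OF fm_pencil_carrier mult_carrier_mat[OF K GH]])
  then show ?thesis using X unfolding fm_DOM_def by simp
qed

text \<open>Mirror image of the forward case. The candidate \<open>?H * G * ?K\<close> appears as a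
  left inverse, which for square matrices is also a right inverse.\<close>

lemma DOM_backward:
  assumes S: "S \<in> carrier_mat (fm_dim \<R>1) (fm_dim \<R>2)" "S * T = 1\<^sub>m (fm_dim \<R>1)"
    and X: "X \<in> fm_DOM d s Y \<R>2 m"
  shows "X \<in> fm_DOM d s Y \<R>1 m"
proof -
  let ?K = "kron (1\<^sub>m m) T" and ?H = "kron (1\<^sub>m m) S"
  let ?M1 = "fm_pencil d s Y \<R>1 m X" and ?M2 = "fm_pencil d s Y \<R>2 m X"
  let ?n1 = "fm_dim \<R>1 * m" and ?n2 = "fm_dim \<R>2 * m"
  have H: "?H \<in> carrier_mat ?n1 ?n2" by (rule kron_one_carrier[OF S(1)])
  note K = kron_carrier[of m]
  obtain G where G: "G \<in> carrier_mat ?n2 ?n2" "G * ?M2 = 1\<^sub>m ?n2"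
    using mat_inverse_det[OF fm_pencil_carrier] X unfolding fm_DOM_def by blast
  have HG: "?H * G \<in> carrier_mat ?n1 ?n2" by (rule mult_carrier_mat[OF H G(1)])
  have "?H * G * ?K * ?M1 = ?H * G * (?K * ?M1)"
    by (rule assoc_mult_mat[OF HG K fm_pencil_carrier])
  also have "\<dots> = ?H * G * ?M2 * ?K"
    unfolding pencil_intertwine by (rule assoc_mult_mat[OF HG fm_pencil_carrier K, symmetric])
  also have "?H * G * ?M2 = ?H"
    using assoc_mult_mat[OF H G(1) fm_pencil_carrier] G(2) H by simp
  also have "?H * ?K = 1\<^sub>m ?n1" by (simp add: kron_one_mult[OF S(1) T] S(2) kron_one_one)
  finally have "?H * G * ?K * ?M1 = 1\<^sub>m ?n1" .
  then have "?M1 * (?H * G * ?K) = 1\<^sub>m ?n1"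
    by (rule mat_mult_left_right_inverse[OF mult_carrier_mat[OF HG K] fm_pencil_carrier])
  then have "det ?M1 \<noteq> 0"
    by (intro det_nonzeroI[OF fm_pencil_carrier mult_carrier_mat[OF HG K]])
  then show ?thesis using X unfolding fm_DOM_def by simp
qed

lemma realizes_forward:
  assumes "S \<in> carrier_mat (fm_dim \<R>1) (fm_dim \<R>2)" "T * S = 1\<^sub>m (fm_dim \<R>2)"
    and "fm_realizes d s Y \<R>1 R"
  shows "fm_realizes d s Y \<R>2 R"
  using assms(3) R2 DOM_forward[OF assms(1,2)] eval_eq unfolding fm_realizes_def by (auto 4 4)

lemma realizes_backward:
  assumes "S \<in> carrier_mat (fm_dim \<R>1) (fm_dim \<R>2)" "S * T = 1\<^sub>m (fm_dim \<R>1)"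
    and "fm_realizes d s Y \<R>2 R"
  shows "fm_realizes d s Y \<R>1 R"
  using assms(3) R1 DOM_backward[OF assms(1,2)] eval_eq unfolding fm_realizes_def by (auto 4 4)

end


section \<open>Reduction to controllable and observable realizations\<close>

lemma mat_prod_carrier:
  assumes "\<And>M. M \<in> set Ms \<Longrightarrow> M \<in> carrier_mat n n"
  shows "mat_prod n Ms \<in> carrier_mat n n"
  using assms by (induction Ms) (auto simp: mat_prod_def intro!: mult_carrier_mat)

lemma mat_prod_Cons: "mat_prod n (M # Ms) = M * mat_prod n Ms"
  by (simp add: mat_prod_def)

lemma mat_prod_append:
  fixes Ms :: "'a::semiring_1 mat list"
  assumes "\<And>M. M \<in> set Ms \<union> set Ns \<Longrightarrow> M \<in> carrier_mat n n"
  shows "mat_prod n (Ms @ Ns) = mat_prod n Ms * mat_prod n Ns"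
  using assms
proof (induction Ms)
  case Nil
  then have "mat_prod n Ns \<in> carrier_mat n n" by (intro mat_prod_carrier) auto
  then show ?case by (simp add: mat_prod_def)
next
  case (Cons M Ms)
  have "M \<in> carrier_mat n n" "mat_prod n Ms \<in> carrier_mat n n" "mat_prod n Ns \<in> carrier_mat n n"
    using Cons.prems by (auto intro!: mat_prod_carrier)
  from assoc_mult_mat[OF this] show ?case using Cons by (simp add: mat_prod_Cons)
qed

lemma fm_A_word_Cons: "fm_A_word \<R> ((k, X) # ws) = fm_A \<R> k X * fm_A_word \<R> ws"
  by (simp add: fm_A_word_def mat_prod_Cons)

lemma fm_words_Cons: "k < d \<Longrightarrow> X \<in> carrier_mat s s \<Longrightarrow> ws \<in> fm_words d s \<Longrightarrow> (k, X) # ws \<in> fm_words d s"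
  by (auto simp: fm_words_def)

lemma fm_words_append: "ws \<in> fm_words d s \<Longrightarrow> vs \<in> fm_words d s \<Longrightarrow> ws @ vs \<in> fm_words d s"
  by (auto simp: fm_words_def)

context
  fixes d s :: nat and \<R> :: "'a::field fm_real"
  assumes real: "fm_realization d s \<R>"
begin

lemma fm_A_word_carrier: "ws \<in> fm_words d s \<Longrightarrow> fm_A_word \<R> ws \<in> carrier_mat (fm_dim \<R>) (fm_dim \<R>)"
  unfolding fm_A_word_def fm_words_def
  by (rule mat_prod_carrier) (use fm_realizationD(3)[OF real] in auto)

lemma fm_A_word_append:
  assumes "ws \<in> fm_words d s" "vs \<in> fm_words d s"
  shows "fm_A_word \<R> (ws @ vs) = fm_A_word \<R> ws * fm_A_word \<R> vs"
  unfolding fm_A_word_def map_append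
  by (rule mat_prod_append) (use assms fm_realizationD(3)[OF real] in \<open>auto simp: fm_words_def\<close>)

text \<open>When \<open>Q * P = 1\<close>, the new state maps are the restrictions to the image of
  \<open>P\<close> if that image is invariant, and the maps on the quotient by the kernel of
  \<open>Q\<close> if that kernel is invariant. One definition thus serves both reductions.\<close>

definition fm_compress :: "'a mat \<Rightarrow> 'a mat \<Rightarrow> 'a fm_real" where
  "fm_compress P Q = \<lparr>fm_dim = dim_row Q, fm_D = fm_D \<R>, fm_C = fm_C \<R> * P,
     fm_A = \<lambda>k X. Q * (fm_A \<R> k X * P), fm_B = \<lambda>k X. Q * fm_B \<R> k X\<rparr>"

lemma fm_realization_compress:
  assumes P: "P \<in> carrier_mat (fm_dim \<R>) r" and Q: "Q \<in> carrier_mat r (fm_dim \<R>)"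
  shows "fm_realization d s (fm_compress P Q)"
proof -
  have "linear_mat_map s r r (\<lambda>X. Q * (fm_A \<R> k X * P))" "linear_mat_map s r s (\<lambda>X. Q * fm_B \<R> k X)"
    if k: "k < d" for k
  proof -
    have A: "linear_mat_map s (fm_dim \<R>) (fm_dim \<R>) (fm_A \<R> k)" and B: "linear_mat_map s (fm_dim \<R>) s (fm_B \<R> k)"
      using real k unfolding fm_realization_def by blast+
    note A' = fm_realizationD(3)[OF real k] and B' = fm_realizationD(4)[OF real k]
    have AP: "fm_A \<R> k X * P \<in> carrier_mat (fm_dim \<R>) r" if "X \<in> carrier_mat s s" for X
      using A'[OF that] P by simp
    show "linear_mat_map s r r (\<lambda>X. Q * (fm_A \<R> k X * P))"
      unfolding linear_mat_map_def
    proof (intro conjI ballI allI)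
      fix X Y :: "'a mat" and c :: 'a assume X: "X \<in> carrier_mat s s" and Y: "Y \<in> carrier_mat s s"
      show "Q * (fm_A \<R> k X * P) \<in> carrier_mat r r" using Q AP[OF X] by simp
      have "fm_A \<R> k (X + Y) = fm_A \<R> k X + fm_A \<R> k Y" using A X Y unfolding linear_mat_map_def by blast
      then show "Q * (fm_A \<R> k (X + Y) * P) = Q * (fm_A \<R> k X * P) + Q * (fm_A \<R> k Y * P)"
        using add_mult_distrib_mat[OF A'[OF X] A'[OF Y] P] mult_add_distrib_mat[OF Q AP[OF X] AP[OF Y]] by simp
      have "fm_A \<R> k (c \<cdot>\<^sub>m X) = c \<cdot>\<^sub>m fm_A \<R> k X" using A X unfolding linear_mat_map_def by blast
      then show "Q * (fm_A \<R> k (c \<cdot>\<^sub>m X) * P) = c \<cdot>\<^sub>m (Q * (fm_A \<R> k X * P))"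
        using mult_smult_assoc_mat[OF A'[OF X] P] mult_smult_distrib[OF Q AP[OF X]] by simp
    qed
    show "linear_mat_map s r s (\<lambda>X. Q * fm_B \<R> k X)"
      unfolding linear_mat_map_def
    proof (intro conjI ballI allI)
      fix X Y :: "'a mat" and c :: 'a assume X: "X \<in> carrier_mat s s" and Y: "Y \<in> carrier_mat s s"
      show "Q * fm_B \<R> k X \<in> carrier_mat r s" using Q B'[OF X] by simp
      have "fm_B \<R> k (X + Y) = fm_B \<R> k X + fm_B \<R> k Y" using B X Y unfolding linear_mat_map_def by blast
      then show "Q * fm_B \<R> k (X + Y) = Q * fm_B \<R> k X + Q * fm_B \<R> k Y"
        using mult_add_distrib_mat[OF Q B'[OF X] B'[OF Y]] by simp
      have "fm_B \<R> k (c \<cdot>\<^sub>m X) = c \<cdot>\<^sub>m fm_B \<R> k X" using B X unfolding linear_mat_map_def by blast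
      then show "Q * fm_B \<R> k (c \<cdot>\<^sub>m X) = c \<cdot>\<^sub>m (Q * fm_B \<R> k X)"
        using mult_smult_distrib[OF Q B'[OF X]] by simp
    qed
  qed
  then show ?thesis
    using fm_realizationD(1,2)[OF real] P Q unfolding fm_realization_def fm_compress_def by auto
qed

text \<open>\<open>P * Q\<close> fixes every vector of the controllable subspace \<open>W\<close>.
  As \<open>W\<close> is invariant under the state maps and contains all inputs, the factor
  \<open>P * Q\<close> disappears from \<open>P * Q * A * P\<close> and \<open>P * Q * B\<close>,
  which is what makes \<open>P\<close> a morphism.\<close>

lemma uncontrollable_reduction:
  assumes nc: "\<not> fm_controllable d s \<R>" and rz: "fm_realizes d s Y \<R> R"
  shows "\<exists>\<R>'. fm_realizes d s Y \<R>' R \<and> fm_dim \<R>' < fm_dim \<R>"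
proof -
  define S where "S = {(fm_A_word \<R> ws * fm_B \<R> k X) *\<^sub>v u | ws k X u.
      ws \<in> fm_words d s \<and> k < d \<and> X \<in> carrier_mat s s \<and> u \<in> carrier_vec s}"
  define W where "W = LinearCombinations.module.span class_ring (module_vec TYPE('a) (fm_dim \<R>)) S"
  note A = fm_realizationD(3)[OF real] and B = fm_realizationD(4)[OF real]
  have S: "S \<subseteq> carrier_vec (fm_dim \<R>)"
    unfolding S_def using fm_A_word_carrier B by (auto intro!: mult_mat_vec_carrier mult_carrier_mat)
  note closed = span_vec_closed[OF S, folded W_def]
  have "W \<noteq> carrier_vec (fm_dim \<R>)" using nc unfolding fm_controllable_def W_def S_def by blast
  then obtain r P Q where r: "r < fm_dim \<R>" and P: "P \<in> carrier_mat (fm_dim \<R>) r" and Q: "Q \<in> carrier_mat r (fm_dim \<R>)"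
    and QP: "Q * P = 1\<^sub>m r" and PW: "\<And>v. v \<in> carrier_vec r \<Longrightarrow> P *\<^sub>v v \<in> W"
    and PQ: "\<And>w. w \<in> W \<Longrightarrow> P *\<^sub>v (Q *\<^sub>v w) = w"
    using subspace_parametrization[OF closed(2-5)] by blast
  \<comment> \<open>A letter put in front of a generating word gives another generator; the span
    principle extends this to all of \<open>W\<close>.\<close>
  have AW: "fm_A \<R> k X *\<^sub>v w \<in> W" if k: "k < d" and X: "X \<in> carrier_mat s s" and w: "w \<in> W" for k X w
  proof -
    note AkX = A[OF k X]
    have "W \<subseteq> {w \<in> carrier_vec (fm_dim \<R>). fm_A \<R> k X *\<^sub>v w \<in> W}"
      unfolding W_def
    proof (rule span_vec_least, fold W_def)
      show "S \<subseteq> {w \<in> carrier_vec (fm_dim \<R>). fm_A \<R> k X *\<^sub>v w \<in> W}"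
      proof (intro subsetI CollectI conjI)
        fix w assume w: "w \<in> S"
        then show "w \<in> carrier_vec (fm_dim \<R>)" using S by blast
        from w obtain ws l Z u where ws: "ws \<in> fm_words d s" and l: "l < d" and Z: "Z \<in> carrier_mat s s"
          and u: "u \<in> carrier_vec s" and w_eq: "w = (fm_A_word \<R> ws * fm_B \<R> l Z) *\<^sub>v u"
          unfolding S_def by blast
        note Aw = fm_A_word_carrier[OF ws] and BlZ = B[OF l Z]
        have "fm_A \<R> k X *\<^sub>v w = (fm_A \<R> k X * (fm_A_word \<R> ws * fm_B \<R> l Z)) *\<^sub>v u"
          unfolding w_eq by (rule assoc_mult_mat_vec[OF AkX mult_carrier_mat[OF Aw BlZ] u, symmetric])
        also have "fm_A \<R> k X * (fm_A_word \<R> ws * fm_B \<R> l Z) = fm_A_word \<R> ((k, X) # ws) * fm_B \<R> l Z"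
          unfolding fm_A_word_Cons by (rule assoc_mult_mat[OF AkX Aw BlZ, symmetric])
        finally show "fm_A \<R> k X *\<^sub>v w \<in> W"
          using closed(1) fm_words_Cons[OF k X ws] l Z u unfolding S_def by blast
      qed
      have "fm_A \<R> k X *\<^sub>v 0\<^sub>v (fm_dim \<R>) = 0\<^sub>v (fm_dim \<R>)" using AkX by (intro eq_vecI) auto
      then show "0\<^sub>v (fm_dim \<R>) \<in> {w \<in> carrier_vec (fm_dim \<R>). fm_A \<R> k X *\<^sub>v w \<in> W}" using closed(3) by simp
    qed (use AkX closed(4,5) in \<open>auto simp: mult_add_distrib_mat_vec[OF AkX] mult_mat_vec[OF AkX]\<close>)
    then show ?thesis using w by blast
  qed
  \<comment> \<open>Inputs are generators with the empty word.\<close>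
  have BW: "fm_B \<R> k X *\<^sub>v u \<in> W" if "k < d" "X \<in> carrier_mat s s" "u \<in> carrier_vec s" for k X u
  proof -
    have "fm_B \<R> k X = fm_A_word \<R> [] * fm_B \<R> k X"
      using B[OF that(1,2)] by (simp add: fm_A_word_def mat_prod_def)
    moreover have "[] \<in> fm_words d s" by (simp add: fm_words_def)
    ultimately show ?thesis using closed(1) that unfolding S_def by fastforce
  qed
  define \<R>' where "\<R>' = fm_compress P Q"
  have dim: "fm_dim \<R>' = r" using Q by (simp add: \<R>'_def fm_compress_def)
  interpret fm_morphism d s \<R>' \<R> P
  proof
    show "fm_realization d s \<R>'" unfolding \<R>'_def by (rule fm_realization_compress[OF P Q])
    show "P \<in> carrier_mat (fm_dim \<R>) (fm_dim \<R>')" using P dim by simp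
    show "fm_C \<R> * P = fm_C \<R>'" "fm_D \<R> = fm_D \<R>'" by (simp_all add: \<R>'_def fm_compress_def)
    fix k :: nat and X :: "'a mat" assume k: "k < d" and X: "X \<in> carrier_mat s s"
    note AkX = A[OF k X] and BkX = B[OF k X]
    have AP: "fm_A \<R> k X * P \<in> carrier_mat (fm_dim \<R>) r" by (rule mult_carrier_mat[OF AkX P])
    have "P * (Q * (fm_A \<R> k X * P)) = fm_A \<R> k X * P"
    proof (rule mat_eq_mult_vecI[OF mult_carrier_mat[OF P mult_carrier_mat[OF Q AP]] AP])
      fix v :: "'a vec" assume v: "v \<in> carrier_vec r"
      have "(P * (Q * (fm_A \<R> k X * P))) *\<^sub>v v = P *\<^sub>v (Q *\<^sub>v ((fm_A \<R> k X * P) *\<^sub>v v))"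
        by (simp only: assoc_mult_mat_vec[OF P mult_carrier_mat[OF Q AP] v] assoc_mult_mat_vec[OF Q AP v])
      also have "\<dots> = (fm_A \<R> k X * P) *\<^sub>v v"
        unfolding assoc_mult_mat_vec[OF AkX P v] by (rule PQ[OF AW[OF k X PW[OF v]]])
      finally show "(P * (Q * (fm_A \<R> k X * P))) *\<^sub>v v = (fm_A \<R> k X * P) *\<^sub>v v" .
    qed
    then show "P * fm_A \<R>' k X = fm_A \<R> k X * P" by (simp add: \<R>'_def fm_compress_def)
    have "P * (Q * fm_B \<R> k X) = fm_B \<R> k X"
    proof (rule mat_eq_mult_vecI[OF mult_carrier_mat[OF P mult_carrier_mat[OF Q BkX]] BkX])
      fix v :: "'a vec" assume v: "v \<in> carrier_vec s"
      show "(P * (Q * fm_B \<R> k X)) *\<^sub>v v = fm_B \<R> k X *\<^sub>v v"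
        by (simp only: assoc_mult_mat_vec[OF P mult_carrier_mat[OF Q BkX] v] assoc_mult_mat_vec[OF Q BkX v]
            PQ[OF BW[OF k X v]])
    qed
    then show "P * fm_B \<R>' k X = fm_B \<R> k X" by (simp add: \<R>'_def fm_compress_def)
  qed (rule real)
  \<comment> \<open>The arrow ends in the given realization, so the property is pulled back along
    it, with \<open>Q\<close> as left inverse of \<open>P\<close>.\<close>
  have "fm_realizes d s Y \<R>' R" using Q QP dim rz by (intro realizes_backward) auto
  then show ?thesis using r dim by blast
qed

text \<open>The dual of the previous argument: the annihilator of the unobservable subspace is invariant
  under the transposed state maps, so no complement of a kernel has to be chosen.\<close>

lemma unobservable_reduction:
  assumes no: "\<not> fm_observable d s \<R>" and rz: "fm_realizes d s Y \<R> R"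
  shows "\<exists>\<R>'. fm_realizes d s Y \<R>' R \<and> fm_dim \<R>' < fm_dim \<R>"
proof -
  define N where "N = {v \<in> carrier_vec (fm_dim \<R>). \<forall>ws\<in>fm_words d s. (fm_C \<R> * fm_A_word \<R> ws) *\<^sub>v v = 0\<^sub>v s}"
  define W where "W = {w \<in> carrier_vec (fm_dim \<R>). \<forall>v\<in>N. w \<bullet> v = 0}"
  note A = fm_realizationD(3)[OF real] and B = fm_realizationD(4)[OF real] and C = fm_realizationD(2)[OF real]
  have N: "N \<subseteq> carrier_vec (fm_dim \<R>)" by (auto simp: N_def)
  obtain v0 where v0: "v0 \<in> N" "v0 \<noteq> 0\<^sub>v (fm_dim \<R>)" using no unfolding fm_observable_def N_def by blast
  obtain i where i: "i < fm_dim \<R>" "v0 $ i \<noteq> 0"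
    using v0 N by (metis (mono_tags) carrier_vecD eq_vecI index_zero_vec subsetD)
  \<comment> \<open>A coordinate where the unobservable vector \<open>v0\<close> is nonzero gives a
    unit vector outside the annihilator, so \<open>W\<close> is proper.\<close>
  have "unit_vec (fm_dim \<R>) i \<bullet> v0 = v0 $ i" using i v0 N by auto
  then have "unit_vec (fm_dim \<R>) i \<notin> W" using v0 i unfolding W_def by auto
  then have proper: "W \<noteq> carrier_vec (fm_dim \<R>)" using unit_vec_carrier by metis
  obtain r P Q where r: "r < fm_dim \<R>" and P: "P \<in> carrier_mat (fm_dim \<R>) r" and Q: "Q \<in> carrier_mat r (fm_dim \<R>)"
    and QP: "Q * P = 1\<^sub>m r" and PW: "\<And>v. v \<in> carrier_vec r \<Longrightarrow> P *\<^sub>v v \<in> W"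
    and PQ: "\<And>w. w \<in> W \<Longrightarrow> P *\<^sub>v (Q *\<^sub>v w) = w"
  proof (rule subspace_parametrization[of W "fm_dim \<R>"])
    fix x y and c :: 'a assume "x \<in> W" "y \<in> W"
    then show "x + y \<in> W" "c \<cdot>\<^sub>v x \<in> W"
      using N by (auto simp: W_def add_scalar_prod_distrib[of _ "fm_dim \<R>"] smult_scalar_prod_distrib[of _ "fm_dim \<R>"] subset_iff)
  qed (use N proper in \<open>auto simp: W_def\<close>)
  \<comment> \<open>Dually to controllability, the new letter is appended at the right end of the
    word, next to the vector.\<close>
  have AN: "fm_A \<R> k X *\<^sub>v v \<in> N" if k: "k < d" and X: "X \<in> carrier_mat s s" and v: "v \<in> N" for k X v
  proof -
    have vL: "v \<in> carrier_vec (fm_dim \<R>)" using v N by blast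
    note AkX = A[OF k X]
    have "(fm_C \<R> * fm_A_word \<R> ws) *\<^sub>v (fm_A \<R> k X *\<^sub>v v) = 0\<^sub>v s" if ws: "ws \<in> fm_words d s" for ws
    proof -
      note Aw = fm_A_word_carrier[OF ws]
      have w1: "[(k, X)] \<in> fm_words d s" using k X by (auto simp: fm_words_def)
      have "fm_A_word \<R> (ws @ [(k, X)]) = fm_A_word \<R> ws * fm_A \<R> k X"
        using AkX by (simp add: fm_A_word_append[OF ws w1]) (simp add: fm_A_word_def mat_prod_def)
      then have "(fm_C \<R> * fm_A_word \<R> ws) *\<^sub>v (fm_A \<R> k X *\<^sub>v v) =
        (fm_C \<R> * fm_A_word \<R> (ws @ [(k, X)])) *\<^sub>v v"
        by (simp only: assoc_mult_mat_vec[OF mult_carrier_mat[OF C Aw] AkX vL, symmetric]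
            assoc_mult_mat[OF C Aw AkX])
      then show ?thesis using v fm_words_append[OF ws w1] by (simp add: N_def)
    qed
    then show ?thesis using AkX vL by (simp add: N_def)
  qed
  have AW: "(fm_A \<R> k X)\<^sup>T *\<^sub>v w \<in> W" if k: "k < d" and X: "X \<in> carrier_mat s s" and w: "w \<in> W" for k X w
  proof -
    note AkX = A[OF k X]
    have "((fm_A \<R> k X)\<^sup>T *\<^sub>v w) \<bullet> v = 0" if v: "v \<in> N" for v
    proof -
      have "((fm_A \<R> k X)\<^sup>T *\<^sub>v w) \<bullet> v = w \<bullet> (fm_A \<R> k X *\<^sub>v v)"
        using v N w by (intro transpose_vec_mult_scalar[OF AkX]) (auto simp: W_def)
      also have "\<dots> = 0" using w AN[OF k X v] by (simp add: W_def)
      finally show ?thesis .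
    qed
    then show ?thesis using AkX w by (auto simp: W_def intro!: mult_mat_vec_carrier)
  qed
  have CW: "(fm_C \<R>)\<^sup>T *\<^sub>v u \<in> W" if u: "u \<in> carrier_vec s" for u
  proof -
    have "((fm_C \<R>)\<^sup>T *\<^sub>v u) \<bullet> v = 0" if v: "v \<in> N" for v
    proof -
      have vL: "v \<in> carrier_vec (fm_dim \<R>)" using v N by blast
      have "(fm_C \<R> * fm_A_word \<R> []) *\<^sub>v v = 0\<^sub>v s"
        using v unfolding N_def fm_words_def by blast
      then have "fm_C \<R> *\<^sub>v v = 0\<^sub>v s" using C by (simp add: fm_A_word_def mat_prod_def)
      then show ?thesis using transpose_vec_mult_scalar[OF C vL u] u by simp
    qed
    then show ?thesis using C u by (auto simp: W_def intro!: mult_mat_vec_carrier)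
  qed
  have PT: "P\<^sup>T \<in> carrier_mat r (fm_dim \<R>)" and QT: "Q\<^sup>T \<in> carrier_mat (fm_dim \<R>) r" using P Q by auto
  \<comment> \<open>The hypothesis \<open>MW\<close> says that the row space of \<open>M\<close>
    lies in \<open>W\<close>, which \<open>P * Q\<close> fixes. The transposed identity is used for
    \<open>M = fm_C \<R>\<close> and for \<open>P\<^sup>T\<close> times a state map.\<close>
  have PQT: "M * (Q\<^sup>T * P\<^sup>T) = M"
    if M: "M \<in> carrier_mat p (fm_dim \<R>)" and MW: "\<And>u. u \<in> carrier_vec p \<Longrightarrow> M\<^sup>T *\<^sub>v u \<in> W" for M p
  proof -
    have MT: "M\<^sup>T \<in> carrier_mat (fm_dim \<R>) p" using M by simp
    have "P * Q * M\<^sup>T = M\<^sup>T"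
    proof (rule mat_eq_mult_vecI[OF mult_carrier_mat[OF mult_carrier_mat[OF P Q] MT] MT])
      fix u :: "'a vec" assume u: "u \<in> carrier_vec p"
      show "(P * Q * M\<^sup>T) *\<^sub>v u = M\<^sup>T *\<^sub>v u"
        by (simp only: assoc_mult_mat_vec[OF mult_carrier_mat[OF P Q] MT u]
            assoc_mult_mat_vec[OF P Q mult_mat_vec_carrier[OF MT u]] PQ[OF MW[OF u]])
    qed
    then have "(P * Q * M\<^sup>T)\<^sup>T = M" by simp
    then show ?thesis
      by (simp add: transpose_mult[OF mult_carrier_mat[OF P Q] MT] transpose_mult[OF P Q])
  qed
  define \<R>' where "\<R>' = fm_compress (Q\<^sup>T) (P\<^sup>T)"
  have dim: "fm_dim \<R>' = r" using P by (simp add: \<R>'_def fm_compress_def)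
  interpret fm_morphism d s \<R> \<R>' "P\<^sup>T"
  proof
    show "fm_realization d s \<R>'" unfolding \<R>'_def by (rule fm_realization_compress[OF QT PT])
    show "P\<^sup>T \<in> carrier_mat (fm_dim \<R>') (fm_dim \<R>)" using P dim by simp
    show "fm_D \<R>' = fm_D \<R>" by (simp add: \<R>'_def fm_compress_def)
    show "fm_C \<R>' * P\<^sup>T = fm_C \<R>"
      using assoc_mult_mat[OF C QT PT] PQT[OF C CW] by (simp add: \<R>'_def fm_compress_def)
    fix k :: nat and X :: "'a mat" assume k: "k < d" and X: "X \<in> carrier_mat s s"
    note AkX = A[OF k X]
    show "P\<^sup>T * fm_B \<R> k X = fm_B \<R>' k X" by (simp add: \<R>'_def fm_compress_def)
    have PA: "P\<^sup>T * fm_A \<R> k X \<in> carrier_mat r (fm_dim \<R>)" by (rule mult_carrier_mat[OF PT AkX])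
    have "(P\<^sup>T * fm_A \<R> k X)\<^sup>T *\<^sub>v u \<in> W" if u: "u \<in> carrier_vec r" for u
    proof -
      have "(P\<^sup>T * fm_A \<R> k X)\<^sup>T *\<^sub>v u = (fm_A \<R> k X)\<^sup>T *\<^sub>v (P *\<^sub>v u)"
        using AkX P u by (simp add: transpose_mult[OF PT AkX])
      then show ?thesis using AW[OF k X PW[OF u]] by simp
    qed
    note PQT[OF PA this]
    moreover have "P\<^sup>T * (fm_A \<R> k X * Q\<^sup>T) * P\<^sup>T = P\<^sup>T * fm_A \<R> k X * (Q\<^sup>T * P\<^sup>T)"
      by (simp only: assoc_mult_mat[OF PT AkX QT, symmetric] assoc_mult_mat[OF PA QT PT])
    ultimately show "P\<^sup>T * fm_A \<R> k X = fm_A \<R>' k X * P\<^sup>T"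
      by (simp add: \<R>'_def fm_compress_def)
  qed (rule real)
  have "P\<^sup>T * Q\<^sup>T = 1\<^sub>m r" using transpose_mult[OF Q P] QP by simp
  \<comment> \<open>Now the arrow starts at the given realization, so the property is pushed
    forward, with \<open>Q\<^sup>T\<close> as right inverse of \<open>P\<^sup>T\<close>.\<close>
  then have "fm_realizes d s Y \<R>' R" using QT dim rz by (intro realizes_forward) auto
  then show ?thesis using r dim by blast
qed

end


section \<open>Rational expressions at block upper triangular tuples\<close>

lemma mat_block_mult:
  fixes M N :: "'a::comm_semiring_0 mat"
  assumes M: "M \<in> carrier_mat (s * m) (s * m)" and N: "N \<in> carrier_mat (s * m) (s * m)"
    and ij: "i < m" "j < m"
  shows "mat_block s (M * N) i j = mat_sum s s (\<lambda>l. mat_block s M i l * mat_block s N l j) {..<m}"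
proof -
  have "M * N = block_mat s s m (mat_block s M) * block_mat s s m (mat_block s N)"
    by (simp only: block_mat_mat_block[OF M] block_mat_mat_block[OF N])
  also have "\<dots> = block_mat s s m (\<lambda>i j. mat_sum s s (\<lambda>l. mat_block s M i l * mat_block s N l j) {..<m})"
    by (rule block_mat_mult) simp_all
  finally show ?thesis using ij by (simp add: mat_block_block_mat)
qed

lemma mat_block_add:
  assumes "M \<in> carrier_mat (s * m) (s * m)" "N \<in> carrier_mat (s * m) (s * m)" "i < m" "j < m"
  shows "mat_block s (M + N) i j = mat_block s M i j + mat_block s N i j"
  using assms by (intro eq_matI) (auto simp: mat_block_def block_index_less)

lemma mat_block_smult:
  assumes "M \<in> carrier_mat (s * m) (s * m)" "i < m" "j < m"
  shows "mat_block s (c \<cdot>\<^sub>m M) i j = c \<cdot>\<^sub>m mat_block s M i j"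
  using assms by (intro eq_matI) (auto simp: mat_block_def block_index_less)

lemma mat_block_mat_sum:
  assumes "i < m" "j < m"
  shows "mat_block s (mat_sum (s * m) (s * m) f I) i j = mat_sum s s (\<lambda>k. mat_block s (f k) i j) I"
  using assms by (intro eq_matI) (auto simp: mat_block_def block_index_less)

lemma mat_block_one:
  assumes "i < m" "j < m"
  shows "mat_block s (1\<^sub>m (s * m)) i j = (if i = j then 1\<^sub>m s else 0\<^sub>m s s)"
  unfolding one_block_mat using assms by (simp add: mat_block_block_mat)

text \<open>The common diagonal block is a parameter because it decides invertibility: in the
  induction over expressions it is the value at \<open>Y\<close>, while the blocks above the
  diagonal stay unrestricted.\<close>

definition block_upper :: "nat \<Rightarrow> nat \<Rightarrow> 'a::zero mat \<Rightarrow> 'a mat \<Rightarrow> bool" where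
  "block_upper s m M0 M \<longleftrightarrow> M \<in> carrier_mat (s * m) (s * m) \<and>
     (\<forall>i<m. mat_block s M i i = M0) \<and> (\<forall>i<m. \<forall>j<i. mat_block s M i j = 0\<^sub>m s s)"

lemma block_upper_carrier: "block_upper s m M0 M \<Longrightarrow> M \<in> carrier_mat (s * m) (s * m)"
  by (simp add: block_upper_def)

lemma block_upper_diag_carrier: "block_upper s m M0 M \<Longrightarrow> 0 < m \<Longrightarrow> M0 \<in> carrier_mat s s"
  by (auto simp: block_upper_def)

lemma block_upper_add:
  fixes M N :: "'a::field mat"
  assumes "block_upper s m M0 M" "block_upper s m N0 N"
  shows "block_upper s m (M0 + N0) (M + N)"
  using assms unfolding block_upper_def by (auto simp: mat_block_add)

lemma block_upper_smult:
  fixes M :: "'a::field mat"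
  assumes "block_upper s m M0 M"
  shows "block_upper s m (c \<cdot>\<^sub>m M0) (c \<cdot>\<^sub>m M)"
  using assms unfolding block_upper_def by (auto simp: mat_block_smult)

lemma block_upper_one: "block_upper s m (1\<^sub>m s) (1\<^sub>m (s * m) :: 'a::field mat)"
  unfolding block_upper_def by (auto simp: mat_block_one)

lemma block_upper_mat_sum:
  fixes M :: "'i \<Rightarrow> 'a::field mat"
  assumes "\<And>k. k \<in> I \<Longrightarrow> block_upper s m (M0 k) (M k)"
  shows "block_upper s m (mat_sum s s M0 I) (mat_sum (s * m) (s * m) M I)"
  using assms unfolding block_upper_def
  by (auto simp: mat_block_mat_sum intro: mat_sum_cong mat_sum_zero)

text \<open>In the block product, terms with \<open>l < i\<close> vanish through \<open>M\<close>
  and terms with \<open>l > i\<close> through \<open>zero\<close>. The assumption concerns a single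
  column of \<open>N\<close>, so the lemma also serves in back substitution, where triangularity of
  \<open>N\<close> is still to be shown.\<close>

lemma block_upper_mult_block:
  fixes M N :: "'a::field mat"
  assumes M: "block_upper s m M0 M" and N: "N \<in> carrier_mat (s * m) (s * m)"
    and ij: "i < m" "j < m" and zero: "\<And>l. i < l \<Longrightarrow> l < m \<Longrightarrow> mat_block s N l j = 0\<^sub>m s s"
  shows "mat_block s (M * N) i j = M0 * mat_block s N i j"
proof -
  have "mat_block s M i l * mat_block s N l j = 0\<^sub>m s s" if "l < m" "l \<noteq> i" for l
  proof (cases "l < i")
    case True
    then have "mat_block s M i l = 0\<^sub>m s s" using M ij unfolding block_upper_def by blast
    then show ?thesis by (simp add: left_mult_zero_mat[OF mat_block_carrier])
  next
    case False
    then have "mat_block s N l j = 0\<^sub>m s s" using zero that by simp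
    then show ?thesis by (simp add: right_mult_zero_mat[OF mat_block_carrier])
  qed
  then have "mat_block s (M * N) i j = mat_block s M i i * mat_block s N i j"
    unfolding mat_block_mult[OF block_upper_carrier[OF M] N ij] using ij
    by (intro mat_sum_delta mult_carrier_mat[OF mat_block_carrier mat_block_carrier]) auto
  then show ?thesis using M ij unfolding block_upper_def by simp
qed

lemma block_upper_mult:
  fixes M N :: "'a::field mat"
  assumes M: "block_upper s m M0 M" and N: "block_upper s m N0 N"
  shows "block_upper s m (M0 * N0) (M * N)"
  unfolding block_upper_def
proof (intro conjI allI impI)
  show "M * N \<in> carrier_mat (s * m) (s * m)"
    by (rule mult_carrier_mat[OF block_upper_carrier[OF M] block_upper_carrier[OF N]])
  fix i assume i: "i < m"
  have eq: "mat_block s (M * N) i j = M0 * mat_block s N i j" if "j \<le> i" for j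
    using N i that by (intro block_upper_mult_block[OF M block_upper_carrier[OF N]]) (auto simp: block_upper_def)
  show "mat_block s (M * N) i i = M0 * N0"
    using eq[of i] N i by (simp add: block_upper_def)
  have M0: "M0 \<in> carrier_mat s s" using block_upper_diag_carrier[OF M] i by simp
  fix j assume j: "j < i"
  then have "mat_block s N i j = 0\<^sub>m s s" using N i unfolding block_upper_def by blast
  then show "mat_block s (M * N) i j = 0\<^sub>m s s"
    using eq[of j] j by (simp add: right_mult_zero_mat[OF M0])
qed

text \<open>Back substitution from the last block row up to row \<open>t\<close>: once the blocks
  below row \<open>i\<close> vanish, row \<open>i\<close> of the product is \<open>M0\<close> times
  the unknown block, and \<open>G0\<close> cancels \<open>M0\<close>. The choice
  \<open>t = 0\<close> yields a trivial kernel, \<open>t = Suc j\<close> triangularity of the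
  inverse.\<close>

lemma block_upper_solve_zero:
  fixes M N :: "'a::field mat"
  assumes M: "block_upper s m M0 M" and N: "N \<in> carrier_mat (s * m) (s * m)"
    and G0: "G0 \<in> carrier_mat s s" "G0 * M0 = 1\<^sub>m s" and j: "j < m"
    and zero: "\<And>i. t \<le> i \<Longrightarrow> i < m \<Longrightarrow> mat_block s (M * N) i j = 0\<^sub>m s s"
    and i: "t \<le> i" "i < m"
  shows "mat_block s N i j = 0\<^sub>m s s"
  using i
proof (induction "m - i" arbitrary: i rule: less_induct)
  case less
  then have "\<And>l. i < l \<Longrightarrow> l < m \<Longrightarrow> mat_block s N l j = 0\<^sub>m s s" by simp
  then have "M0 * mat_block s N i j = 0\<^sub>m s s"
    using block_upper_mult_block[OF M N less.prems(2) j] zero less.prems by simp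
  moreover have M0: "M0 \<in> carrier_mat s s" using block_upper_diag_carrier[OF M] j by simp
  then have "G0 * (M0 * mat_block s N i j) = mat_block s N i j"
    using assoc_mult_mat[OF G0(1) M0 mat_block_carrier, symmetric] G0(2)
    by (simp add: left_mult_one_mat[OF mat_block_carrier])
  ultimately show ?case using G0(1) by simp
qed

lemma block_upper_inverse:
  fixes M :: "'a::field mat"
  assumes M: "block_upper s m M0 M" and G0: "mat_inverse M0 = Some G0" and m: "0 < m"
  obtains G where "mat_inverse M = Some G" "block_upper s m G0 G"
proof -
  note Mc = block_upper_carrier[OF M]
  have M0: "M0 \<in> carrier_mat s s" by (rule block_upper_diag_carrier[OF M m])
  have G0': "G0 \<in> carrier_mat s s" "G0 * M0 = 1\<^sub>m s" "M0 * G0 = 1\<^sub>m s"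
    using mat_inverse(2)[OF M0 G0] by auto
  have "det M \<noteq> 0"
  proof
    assume "det M = 0"
    then obtain v where v: "v \<in> carrier_vec (s * m)" "v \<noteq> 0\<^sub>v (s * m)" "M *\<^sub>v v = 0\<^sub>v (s * m)"
      using det_0_iff_vec_prod_zero_field[OF Mc] by blast
    \<comment> \<open>The kernel vector is repeated in every column, because back substitution is
      stated for square matrices.\<close>
    define N where "N = mat (s * m) (s * m) (\<lambda>(i, j). v $ i)"
    have N: "N \<in> carrier_mat (s * m) (s * m)" by (simp add: N_def)
    have col: "col N j = v" if "j < s * m" for j
      using v that by (intro eq_vecI) (auto simp: N_def)
    have "row M i \<bullet> v = 0" if "i < s * m" for i
      using arg_cong[OF v(3), of "\<lambda>v. v $ i"] that Mc by simp
    then have "M * N = 0\<^sub>m (s * m) (s * m)"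
      using Mc N by (intro eq_matI) (auto simp: col)
    then have MN: "mat_block s (M * N) i j = 0\<^sub>m s s" if "i < m" "j < m" for i j
      using that by (intro eq_matI) (auto simp: mat_block_def block_index_less)
    have "mat_block s N i j = 0\<^sub>m s s" if "i < m" "j < m" for i j
      by (rule block_upper_solve_zero[OF M N G0'(1,2) that(2), of 0]) (use MN that in auto)
    then have N0: "N = block_mat s s m (\<lambda>_ _. 0\<^sub>m s s)"
      using block_mat_mat_block[OF N] block_mat_cong[of m "mat_block s N" "\<lambda>_ _. 0\<^sub>m s s" s s] by simp
    have "v $ i = 0" if "i < s * m" for i
    proof -
      from that obtain k a where ka: "k < m" "a < s" "i = s * k + a" by (rule block_index_cases)
      have "v $ i = N $$ (s * k + a, s * k + a)" using that ka by (simp add: N_def)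
      also have "\<dots> = 0" unfolding N0 using ka by (simp add: block_mat_index)
      finally show ?thesis .
    qed
    then have "v = 0\<^sub>v (s * m)" using v(1) by (intro eq_vecI) auto
    with v(2) show False by simp
  qed
  then obtain G where G: "mat_inverse M = Some G" "G \<in> carrier_mat (s * m) (s * m)" "M * G = 1\<^sub>m (s * m)"
    using mat_inverse_det[OF Mc] by blast
  have zero: "mat_block s G i j = 0\<^sub>m s s" if "j < i" "i < m" for i j
    by (rule block_upper_solve_zero[OF M G(2) G0'(1,2), of j "Suc j"])
      (use that in \<open>auto simp: G(3) mat_block_one\<close>)
  have "mat_block s G i i = G0" if i: "i < m" for i
  proof -
    \<comment> \<open>The blocks of \<open>G\<close> below the diagonal are already zero, so the
      diagonal block of \<open>M * G = 1\<close> involves only \<open>M0\<close>.\<close>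
    have "M0 * mat_block s G i i = 1\<^sub>m s"
      using block_upper_mult_block[OF M G(2) i i] zero i by (simp add: G(3) mat_block_one)
    then have "mat_block s G i i = G0 * M0 * mat_block s G i i" "G0 * (M0 * mat_block s G i i) = G0"
      using G0' by (simp_all add: left_mult_one_mat[OF mat_block_carrier])
    then show ?thesis using assoc_mult_mat[OF G0'(1) M0 mat_block_carrier, of G i i] by simp
  qed
  with zero G have "block_upper s m G0 G" by (auto simp: block_upper_def)
  with G(1) that show thesis by blast
qed

lemma block_upper_mat_prod:
  fixes X Y :: "'i \<Rightarrow> 'a::field mat"
  assumes "\<And>k. k \<in> set w \<Longrightarrow> block_upper s m (Y k) (X k)"
  shows "block_upper s m (mat_prod s (map Y w)) (mat_prod (s * m) (map X w))"
  using assms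
  by (induction w) (auto simp: mat_prod_def intro: block_upper_one block_upper_mult)

text \<open>Block upper triangular tuples with constant diagonal \<open>Y\<close> form an algebra closed under
  inverses, so they lie in every domain containing \<open>Y\<close>.\<close>

lemma rexp_eval_block_upper:
  fixes X Y :: "nat \<Rightarrow> 'a::field mat"
  assumes "rexp_eval s Y R = Some M0" and m: "0 < m"
    and "\<And>k. k \<in> rexp_vars R \<Longrightarrow> block_upper s m (Y k) (X k)"
  shows "\<exists>M. rexp_eval (s * m) X R = Some M \<and> block_upper s m M0 M"
  using assms(1,3)
proof (induction R arbitrary: M0)
  case (Poly p)
  then have "block_upper s m (mat_prod s (map Y w)) (mat_prod (s * m) (map X w))"
    if "w \<in> Poly_Mapping.keys p" for w
    using that by (intro block_upper_mat_prod) auto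
  then show ?case
    using Poly.prems(1) by (auto simp: poly_eval_def intro!: block_upper_mat_sum block_upper_smult)
next
  case (Add P Q)
  then obtain P0 Q0 where "rexp_eval s Y P = Some P0" "rexp_eval s Y Q = Some Q0" "M0 = P0 + Q0"
    by (auto simp: bind_eq_Some_conv)
  moreover from Add this obtain P1 Q1 where "rexp_eval (s * m) X P = Some P1" "block_upper s m P0 P1"
    "rexp_eval (s * m) X Q = Some Q1" "block_upper s m Q0 Q1" by fastforce
  ultimately show ?case by (simp add: block_upper_add)
next
  case (Mult P Q)
  then obtain P0 Q0 where "rexp_eval s Y P = Some P0" "rexp_eval s Y Q = Some Q0" "M0 = P0 * Q0"
    by (auto simp: bind_eq_Some_conv)
  moreover from Mult this obtain P1 Q1 where "rexp_eval (s * m) X P = Some P1" "block_upper s m P0 P1"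
    "rexp_eval (s * m) X Q = Some Q1" "block_upper s m Q0 Q1" by fastforce
  ultimately show ?case by (simp add: block_upper_mult)
next
  case (Inv P)
  then obtain P0 where P0: "rexp_eval s Y P = Some P0" "mat_inverse P0 = Some M0"
    by (auto simp: bind_eq_Some_conv)
  moreover from Inv this obtain P1 where P1: "rexp_eval (s * m) X P = Some P1" "block_upper s m P0 P1"
    by fastforce
  obtain M where "mat_inverse P1 = Some M" "block_upper s m M0 M"
    by (rule block_upper_inverse[OF P1(2) P0(2) m])
  with P1 show ?case by simp
qed


section \<open>Moments\<close>

lemma linear_mat_map_zero:
  assumes "linear_mat_map s p q T"
  shows "T (0\<^sub>m s s) = 0\<^sub>m p q"
proof -
  have "T (0 \<cdot>\<^sub>m 0\<^sub>m s s) = 0 \<cdot>\<^sub>m T (0\<^sub>m s s)" "T (0\<^sub>m s s) \<in> carrier_mat p q"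
    using assms zero_carrier_mat[of s s] unfolding linear_mat_map_def by blast+
  moreover have "0 \<cdot>\<^sub>m 0\<^sub>m s s = (0\<^sub>m s s :: 'a mat)" by (intro eq_matI) auto
  moreover have "0 \<cdot>\<^sub>m M = 0\<^sub>m p q" if "M \<in> carrier_mat p q" for M :: "'a mat"
    using that by (intro eq_matI) auto
  ultimately show ?thesis by metis
qed

lemma block_mat_obtain:
  assumes "V \<in> carrier_mat (p * m) (q * m)"
  obtains f where "\<And>i j. f i j \<in> carrier_mat p q" "V = block_mat p q m f"
proof
  define f where "f i j = mat p q (\<lambda>(a, b). V $$ (p * i + a, q * j + b))" for i j
  show "f i j \<in> carrier_mat p q" for i j by (simp add: f_def)
  show "V = block_mat p q m f" by (rule block_mat_eqI[OF assms]) (simp add: f_def)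
qed

text \<open>The superdiagonal perturbation of \<open>I \<otimes> Y\<close> whose \<open>i\<close>-th step carries the \<open>i\<close>-th letter
  of the word \<open>us\<close>; the top right block of a realization evaluated there is a single moment.\<close>

definition word_step :: "nat \<Rightarrow> (nat \<times> 'a::zero mat) list \<Rightarrow> nat \<Rightarrow> nat \<Rightarrow> nat \<Rightarrow> 'a mat" where
  "word_step s us k i j = (if j = Suc i \<and> i < length us \<and> fst (us ! i) = k then snd (us ! i) else 0\<^sub>m s s)"

text \<open>Each letter joins two consecutive block indices, so a word needs one more block than it
  has letters.\<close>

definition word_tuple ::
    "nat \<Rightarrow> (nat \<Rightarrow> 'a::zero mat) \<Rightarrow> (nat \<times> 'a mat) list \<Rightarrow> nat \<Rightarrow> 'a mat" where
  "word_tuple s Y us k =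
     block_mat s s (Suc (length us)) (\<lambda>i j. if i = j then Y k else word_step s us k i j)"

lemma word_step_carrier:
  assumes "us \<in> fm_words d s"
  shows "word_step s us k i j \<in> carrier_mat s s"
proof (cases "i < length us")
  case True
  then have "us ! i \<in> {..<d} \<times> carrier_mat s s" using assms nth_mem unfolding fm_words_def by blast
  then show ?thesis by (auto simp: word_step_def)
qed (simp add: word_step_def)

lemma word_tuple_block_upper:
  fixes Y :: "nat \<Rightarrow> 'a::field mat"
  assumes us: "us \<in> fm_words d s" and Y: "Y k \<in> carrier_mat s s"
  shows "block_upper s (Suc (length us)) (Y k) (word_tuple s Y us k)"
proof -
  have "mat_block s (word_tuple s Y us k) i j = (if i = j then Y k else word_step s us k i j)"
    if "i < Suc (length us)" "j < Suc (length us)" for i j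
    unfolding word_tuple_def using that word_step_carrier[OF us] Y by (intro mat_block_block_mat) auto
  moreover have "word_tuple s Y us k \<in> carrier_mat (s * Suc (length us)) (s * Suc (length us))"
    unfolding word_tuple_def by (rule block_mat_carrier)
  ultimately show ?thesis unfolding block_upper_def by (auto simp: word_step_def)
qed

lemma word_tuple_shift_block:
  fixes Y :: "nat \<Rightarrow> 'a::field mat"
  assumes us: "us \<in> fm_words d s" and Y: "Y k \<in> carrier_mat s s"
    and ij: "i < Suc (length us)" "j < Suc (length us)"
  shows "mat_block s (word_tuple s Y us k - kron (1\<^sub>m (Suc (length us))) (Y k)) i j = word_step s us k i j"
proof -
  have "word_tuple s Y us k - kron (1\<^sub>m (Suc (length us))) (Y k) =
    block_mat s s (Suc (length us))
      (\<lambda>i j. (if i = j then Y k else word_step s us k i j) - (if i = j then Y k else 0\<^sub>m s s))"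
    unfolding word_tuple_def kron_one_block_mat[OF Y] using Y by (intro block_mat_minus) auto
  also have "\<dots> = block_mat s s (Suc (length us)) (word_step s us k)"
  proof (rule block_mat_cong)
    fix i j
    have "Y k - Y k = 0\<^sub>m s s" "word_step s us k i j - 0\<^sub>m s s = word_step s us k i j"
      using Y word_step_carrier[OF us, of k i j] by auto
    moreover have "word_step s us k i i = 0\<^sub>m s s" by (simp add: word_step_def)
    ultimately show "(if i = j then Y k else word_step s us k i j) - (if i = j then Y k else 0\<^sub>m s s) =
      word_step s us k i j" by auto
  qed
  finally show ?thesis using ij word_step_carrier[OF us] by (simp add: mat_block_block_mat)
qed

text \<open>Each superdiagonal position carries a letter for exactly one variable, so the sum over
  variables has one possibly nonzero term; linearity enters through \<open>T k\<close> sending zero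
  to zero. \<open>T\<close> stands for the family of \<open>A_k\<close> or of
  \<open>B_k\<close>.\<close>

lemma mat_sum_word_step:
  assumes us: "us \<in> fm_words d s" and Y: "\<And>k. k < d \<Longrightarrow> Y k \<in> carrier_mat s s"
    and T: "\<And>k. k < d \<Longrightarrow> linear_mat_map s p q (T k)"
    and ij: "i < Suc (length us)" "j < Suc (length us)"
  shows "mat_sum p q (\<lambda>k. T k (mat_block s (word_tuple s Y us k - kron (1\<^sub>m (Suc (length us))) (Y k)) i j)) {..<d} =
    (if j = Suc i then T (fst (us ! i)) (snd (us ! i)) else 0\<^sub>m p q)" (is "mat_sum p q ?f _ = _")
proof -
  have f: "?f k = T k (word_step s us k i j)" if "k < d" for k
    using word_tuple_shift_block[where Y = Y and k = k, OF us Y[OF that] ij] by simp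
  show ?thesis
  proof (cases "j = Suc i")
    case False
    then have "mat_sum p q ?f {..<d} = 0\<^sub>m p q"
      using linear_mat_map_zero[OF T] by (intro mat_sum_zero) (simp add: f word_step_def)
    then show ?thesis using False by simp
  next
    case True
    then have i: "i < length us" using ij by simp
    then have "us ! i \<in> {..<d} \<times> carrier_mat s s" using us nth_mem unfolding fm_words_def by blast
    then have ui: "fst (us ! i) < d" "snd (us ! i) \<in> carrier_mat s s" by auto
    have fi: "?f (fst (us ! i)) = T (fst (us ! i)) (snd (us ! i))"
      using f[OF ui(1)] True i by (simp add: word_step_def)
    have "mat_sum p q ?f {..<d} = ?f (fst (us ! i))"
    proof (rule mat_sum_delta)
      show "?f (fst (us ! i)) \<in> carrier_mat p q"
        unfolding fi using T[OF ui(1)] ui(2) unfolding linear_mat_map_def by blast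
      fix l assume "l \<in> {..<d}" "l \<noteq> fst (us ! i)"
      then show "?f l = 0\<^sub>m p q" using linear_mat_map_zero[OF T] by (simp add: f word_step_def)
    qed (use ui in auto)
    then show ?thesis using True fi by simp
  qed
qed

lemma mat_minus_eq_zero:
  fixes A B :: "'a::field mat"
  assumes "A \<in> carrier_mat p q" "B \<in> carrier_mat p q" "A - B = 0\<^sub>m p q"
  shows "A = B"
proof (rule eq_matI)
  fix i j assume "i < dim_row B" "j < dim_col B"
  then show "A $$ (i, j) = B $$ (i, j)"
    using arg_cong[OF assms(3), of "\<lambda>M. M $$ (i, j)"] assms(1,2) by simp
qed (use assms in auto)

text \<open>The state matrix lives on the superdiagonal, so the state equation reads block row
  \<open>i\<close> from block row \<open>Suc i\<close>. In the last block column the recursion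
  starts with the input of the last letter and multiplies by one state map per earlier
  letter.\<close>

lemma fm_eval_word_tuple:
  fixes \<R> :: "'a::field fm_real"
  assumes real: "fm_realization d s \<R>" and Y: "\<And>k. k < d \<Longrightarrow> Y k \<in> carrier_mat s s"
    and ws: "ws \<in> fm_words d s" and k: "k < d" and X: "X \<in> carrier_mat s s"
  defines "us \<equiv> ws @ [(k, X)]"
  assumes dom: "word_tuple s Y us \<in> fm_DOM d s Y \<R> (Suc (length us))"
  shows "mat_block s (fm_eval d s Y \<R> (Suc (length us)) (word_tuple s Y us)) 0 (length us) =
    fm_C \<R> * (fm_A_word \<R> ws * fm_B \<R> k X)"
proof -
  define L where "L = fm_dim \<R>"
  define n where "n = length us"
  define Z where "Z = (\<lambda>k. word_tuple s Y us k - kron (1\<^sub>m (Suc n)) (Y k))"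
  let ?A = "\<lambda>i. fm_A \<R> (fst (us ! i)) (snd (us ! i))"
  have us: "us \<in> fm_words d s" using ws k X by (auto simp: us_def fm_words_def)
  have A_lin: "linear_mat_map s L L (fm_A \<R> k)" and B_lin: "linear_mat_map s L s (fm_B \<R> k)" if "k < d" for k
    using real that unfolding fm_realization_def L_def by blast+
  note C = fm_realizationD(2)[OF real, folded L_def] and D = fm_realizationD(1)[OF real]
  have BkX: "fm_B \<R> k X \<in> carrier_mat L s" using fm_realizationD(4)[OF real k X] by (simp add: L_def)
  have letter: "fst (us ! i) < d" "snd (us ! i) \<in> carrier_mat s s" if "i < n" for i
  proof -
    have "us ! i \<in> {..<d} \<times> carrier_mat s s" using us that nth_mem unfolding fm_words_def n_def by blast
    then show "fst (us ! i) < d" "snd (us ! i) \<in> carrier_mat s s" by auto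
  qed
  have A_carrier: "?A i \<in> carrier_mat L L" if "i < n" for i
    using fm_realizationD(3)[OF real letter[OF that]] by (simp add: L_def)
  have state: "fm_state d s \<R> Z i j = (if j = Suc i then ?A i else 0\<^sub>m L L)"
    if "i < Suc n" "j < Suc n" for i j
    using mat_sum_word_step[OF us Y A_lin] that unfolding fm_state_def Z_def n_def L_def by simp
  have input: "fm_input d s \<R> Z i j = (if j = Suc i then fm_B \<R> (fst (us ! i)) (snd (us ! i)) else 0\<^sub>m L s)"
    if "i < Suc n" "j < Suc n" for i j
    using mat_sum_word_step[OF us Y B_lin] that unfolding fm_input_def Z_def n_def L_def by simp
  obtain V where V: "V \<in> carrier_mat (L * Suc n) (s * Suc n)"
    "fm_pencil d s Y \<R> (Suc n) (word_tuple s Y us) * V = block_mat L s (Suc n) (fm_input d s \<R> Z)"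
    "fm_eval d s Y \<R> (Suc n) (word_tuple s Y us) = kron (1\<^sub>m (Suc n)) (fm_D \<R>) + kron (1\<^sub>m (Suc n)) (fm_C \<R>) * V"
    unfolding Z_def L_def by (rule fm_eval_solution[OF dom[folded n_def] real])
  obtain f where f: "\<And>i j. f i j \<in> carrier_mat L s" and Vf: "V = block_mat L s (Suc n) f"
    by (rule block_mat_obtain[OF V(1)]) blast
  let ?N = "block_mat L L (Suc n) (fm_state d s \<R> Z)"
  have N: "fm_state d s \<R> Z i j \<in> carrier_mat L L" for i j by (simp add: L_def)
  have pencil: "fm_pencil d s Y \<R> (Suc n) (word_tuple s Y us) = 1\<^sub>m (L * Suc n) - ?N"
    by (simp only: fm_pencil_block_mat Z_def L_def)
  have "block_mat L s (Suc n) (fm_input d s \<R> Z) = (1\<^sub>m (L * Suc n) - ?N) * V"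
    unfolding V(2)[symmetric] pencil ..
  also have "\<dots> = V - ?N * V"
    using minus_mult_distrib_mat[OF one_carrier_mat block_mat_carrier V(1)] left_mult_one_mat[OF V(1)] by simp
  also have "?N * V = block_mat L s (Suc n) (\<lambda>i j. mat_sum L s (\<lambda>l. fm_state d s \<R> Z i l * f l j) {..<Suc n})"
    unfolding Vf by (rule block_mat_mult[OF N f])
  also have "V - \<dots> = block_mat L s (Suc n)
      (\<lambda>i j. f i j - mat_sum L s (\<lambda>l. fm_state d s \<R> Z i l * f l j) {..<Suc n})"
    unfolding Vf by (rule block_mat_minus) simp
  finally have rec: "fm_input d s \<R> Z i j = f i j - mat_sum L s (\<lambda>l. fm_state d s \<R> Z i l * f l j) {..<Suc n}"
    if "i < Suc n" "j < Suc n" for i j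
    by (rule block_mat_eqD) (use that f in \<open>auto simp: L_def intro!: minus_carrier_mat\<close>)
  have prod: "mat_sum L s (\<lambda>l. fm_state d s \<R> Z i l * f l j) {..<Suc n} = ?A i * f (Suc i) j"
    if i: "i < n" and j: "j < Suc n" for i j
  proof -
    have "mat_sum L s (\<lambda>l. fm_state d s \<R> Z i l * f l j) {..<Suc n} = fm_state d s \<R> Z i (Suc i) * f (Suc i) j"
      using i j by (intro mat_sum_delta mult_carrier_mat[OF N f])
        (auto simp: state left_mult_zero_mat[OF f])
    then show ?thesis using i by (simp add: state)
  qed
  \<comment> \<open>The bottom row has neither a state block nor an input block in this
    column.\<close>
  have last: "f n n = 0\<^sub>m L s"
  proof (rule mat_minus_eq_zero[OF f])
    have "mat_sum L s (\<lambda>l. fm_state d s \<R> Z n l * f l n) {..<Suc n} = 0\<^sub>m L s"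
      by (intro mat_sum_zero) (auto simp: state left_mult_zero_mat[OF f])
    then show "f n n - 0\<^sub>m L s = 0\<^sub>m L s" using rec[of n n] by (simp add: input)
  qed simp
  have n: "n = Suc (length ws)" by (simp add: n_def us_def)
  \<comment> \<open>Downward induction on \<open>i\<close>. An input block in column
    \<open>n\<close> occurs only in row \<open>length ws\<close>, where the letter is
    \<open>(k, X)\<close>; the state map of that letter meets \<open>f n n = 0\<close> and drops
    out.\<close>
  have "f i n = fm_A_word \<R> (drop i ws) * fm_B \<R> k X" if "i \<le> length ws" for i
    using that
  proof (induction rule: inc_induct)
    case base
    have "fm_B \<R> k X = f (length ws) n - ?A (length ws) * f n n"
      using rec[of "length ws" n] prod[of "length ws" n] n by (simp add: input us_def)
    also have "?A (length ws) * f n n = 0\<^sub>m L s"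
      unfolding last using A_carrier[of "length ws"] n by simp
    also have "f (length ws) n - 0\<^sub>m L s = f (length ws) n"
      using f[of "length ws" n] by (intro eq_matI) auto
    finally show ?case using BkX by (simp add: fm_A_word_def mat_prod_def L_def)
  next
    case (step i)
    have usi: "us ! i = ws ! i" using step by (simp add: us_def nth_append)
    have "0\<^sub>m L s = f i n - ?A i * f (Suc i) n"
      using rec[of i n] prod[of i n] step n by (simp add: input)
    then have "f i n = ?A i * f (Suc i) n"
      using step n by (intro mat_minus_eq_zero[OF f mult_carrier_mat[OF A_carrier f]]) auto
    also have "\<dots> = ?A i * (fm_A_word \<R> (drop (Suc i) ws) * fm_B \<R> k X)" unfolding step.IH ..
    also have "\<dots> = ?A i * fm_A_word \<R> (drop (Suc i) ws) * fm_B \<R> k X"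
    proof (rule assoc_mult_mat[OF A_carrier _ BkX, symmetric])
      have "drop (Suc i) ws \<in> fm_words d s"
        using ws set_drop_subset[of "Suc i" ws] unfolding fm_words_def by auto
      then show "fm_A_word \<R> (drop (Suc i) ws) \<in> carrier_mat L L"
        using fm_A_word_carrier[OF real] by (simp add: L_def)
    qed (use step n in simp)
    also have "?A i * fm_A_word \<R> (drop (Suc i) ws) = fm_A_word \<R> (drop i ws)"
      using step by (simp add: usi Cons_nth_drop_Suc[symmetric] fm_A_word_def mat_prod_Cons split_beta)
    finally show ?case .
  qed
  from this[of 0] have f0: "f 0 n = fm_A_word \<R> ws * fm_B \<R> k X" by simp
  have CV: "kron (1\<^sub>m (Suc n)) (fm_C \<R>) * V = block_mat s s (Suc n) (\<lambda>i j. fm_C \<R> * f i j)"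
    unfolding Vf by (rule kron_one_mult_block_mat[OF C f])
  have "fm_eval d s Y \<R> (Suc n) (word_tuple s Y us) =
    block_mat s s (Suc n) (\<lambda>i j. (if i = j then fm_D \<R> else 0\<^sub>m s s) + fm_C \<R> * f i j)"
    unfolding V(3) CV kron_one_block_mat[OF D] by (rule block_mat_add) (rule mult_carrier_mat[OF C f])
  moreover have Cf: "fm_C \<R> * f i j \<in> carrier_mat s s" for i j by (rule mult_carrier_mat[OF C f])
  \<comment> \<open>\<open>n\<close> is positive, so the top right block is off the diagonal and
    \<open>fm_D \<R>\<close> does not contribute.\<close>
  ultimately show ?thesis
    using n D Cf by (simp add: n_def[symmetric] mat_block_block_mat f0[symmetric])
qed

section \<open>Comparison of two realizations of the same expression\<close>

lemma fm_moments_eq: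
  fixes R :: "'a::field rexp"
  assumes vars: "rexp_vars R \<subseteq> {..<d}"
    and R1: "fm_realizes d s Y \<R>1 R" and R2: "fm_realizes d s Y \<R>2 R"
    and ws: "ws \<in> fm_words d s" and k: "k < d" and X: "X \<in> carrier_mat s s"
  shows "fm_C \<R>1 * (fm_A_word \<R>1 ws * fm_B \<R>1 k X) = fm_C \<R>2 * (fm_A_word \<R>2 ws * fm_B \<R>2 k X)"
proof -
  define us where "us = ws @ [(k, X)]"
  define m where "m = Suc (length us)"
  have m: "1 \<le> m" by (simp add: m_def)
  have us: "us \<in> fm_words d s" using ws k X by (auto simp: us_def fm_words_def)
  have dom: "Y \<in> rexp_dom d s R" using R1 unfolding fm_realizes_def by blast
  then have Y: "\<And>k. k < d \<Longrightarrow> Y k \<in> carrier_mat s s" unfolding rexp_dom_def tuples_def by blast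
  have bu: "block_upper s m (Y l) (word_tuple s Y us l)" if "l < d" for l
    unfolding m_def by (rule word_tuple_block_upper[where Y = Y and k = l, OF us Y[OF that]])
  obtain M0 where "rexp_eval s Y R = Some M0" using dom unfolding rexp_dom_def by auto
  \<comment> \<open>Sizes of \<open>Y k\<close> are known only for \<open>k < d\<close>, so
    \<open>vars\<close> is what makes the tuple triangular in every variable of
    \<open>R\<close>.\<close>
  then obtain M where M: "rexp_eval (s * m) (word_tuple s Y us) R = Some M"
    using rexp_eval_block_upper[of s Y R M0 m "word_tuple s Y us"] bu vars by (auto simp: m_def)
  then have "word_tuple s Y us \<in> rexp_dom d (s * m) R"
    using block_upper_carrier[OF bu] unfolding rexp_dom_def tuples_def by auto
  then have X12: "word_tuple s Y us \<in> fm_DOM d s Y \<R>i m \<and> M = fm_eval d s Y \<R>i m (word_tuple s Y us)"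
    if "fm_realizes d s Y \<R>i R" for \<R>i
    using that M m unfolding fm_realizes_def by auto
  have "mat_block s M 0 (length us) = fm_C \<R>i * (fm_A_word \<R>i ws * fm_B \<R>i k X)"
    if Ri: "fm_realizes d s Y \<R>i R" for \<R>i
  proof -
    have "fm_realization d s \<R>i" using Ri unfolding fm_realizes_def by blast
    from fm_eval_word_tuple[OF this Y ws k X] show ?thesis
      using X12[OF Ri] by (simp add: us_def m_def)
  qed
  with R1 R2 show ?thesis by metis
qed

lemma fm_dim_le:
  fixes R :: "'a::field rexp"
  assumes vars: "rexp_vars R \<subseteq> {..<d}"
    and R1: "fm_realizes d s Y \<R>1 R" and R2: "fm_realizes d s Y \<R>2 R"
    and contr: "fm_controllable d s \<R>1" and obs: "fm_observable d s \<R>1"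
  shows "fm_dim \<R>1 \<le> fm_dim \<R>2"
proof -
  define L where "L = fm_dim \<R>1"
  define L' where "L' = fm_dim \<R>2"
  have real1: "fm_realization d s \<R>1" and real2: "fm_realization d s \<R>2"
    using R1 R2 unfolding fm_realizes_def by blast+
  define O1 where "O1 ws = fm_C \<R>1 * fm_A_word \<R>1 ws" for ws
  define O2 where "O2 ws = fm_C \<R>2 * fm_A_word \<R>2 ws" for ws
  have O1: "O1 ws \<in> carrier_mat s L" and O2: "O2 ws \<in> carrier_mat s L'" if "ws \<in> fm_words d s" for ws
    unfolding O1_def O2_def L_def L'_def
    by (rule mult_carrier_mat[OF fm_realizationD(2)[OF real1] fm_A_word_carrier[OF real1 that]]
          mult_carrier_mat[OF fm_realizationD(2)[OF real2] fm_A_word_carrier[OF real2 that]])+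
  \<comment> \<open>Two states are related when no output word tells them apart. This is a linear
    subspace of pairs, possibly with many partners for one state.\<close>
  define G where "G x x' \<longleftrightarrow> x \<in> carrier_vec L \<and> x' \<in> carrier_vec L' \<and>
    (\<forall>ws\<in>fm_words d s. O1 ws *\<^sub>v x = O2 ws *\<^sub>v x')" for x x'
  have G_add: "G (x + y) (x' + y')" if "G x x'" "G y y'" for x y x' y'
    using that unfolding G_def
    by (auto simp: mult_add_distrib_mat_vec[OF O1] mult_add_distrib_mat_vec[OF O2])
  have G_smult: "G (c \<cdot>\<^sub>v x) (c \<cdot>\<^sub>v x')" if "G x x'" for c x x'
    using that unfolding G_def by (auto simp: mult_mat_vec[OF O1] mult_mat_vec[OF O2])
  have G_zero: "G (0\<^sub>v L) (0\<^sub>v L')"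
    unfolding G_def
  proof (intro conjI ballI)
    fix ws :: "(nat \<times> 'a mat) list" assume ws: "ws \<in> fm_words d s"
    have "O1 ws *\<^sub>v 0\<^sub>v L = 0\<^sub>v s" "O2 ws *\<^sub>v 0\<^sub>v L' = 0\<^sub>v s"
      using O1[OF ws] O2[OF ws] by (auto intro!: eq_vecI)
    then show "O1 ws *\<^sub>v 0\<^sub>v L = O2 ws *\<^sub>v 0\<^sub>v L'" by simp
  qed auto
  \<comment> \<open>Controllability rewrites the whole space as a span, so partners are sought only
    for generators: the same word, letter and input vector, read in \<open>\<R>2\<close>.\<close>
  have "carrier_vec L \<subseteq> {x. \<exists>x'. G x x'}"
    using contr unfolding fm_controllable_def L_def[symmetric]
  proof (rule subst, intro span_vec_least subsetI)
    fix x assume "x \<in> {(fm_A_word \<R>1 ws * fm_B \<R>1 k X) *\<^sub>v u | ws k X u.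
      ws \<in> fm_words d s \<and> k < d \<and> X \<in> carrier_mat s s \<and> u \<in> carrier_vec s}"
    then obtain vs k X u where vs: "vs \<in> fm_words d s" and k: "k < d" and X: "X \<in> carrier_mat s s"
      and u: "u \<in> carrier_vec s" and x: "x = (fm_A_word \<R>1 vs * fm_B \<R>1 k X) *\<^sub>v u" by blast
    \<comment> \<open>Observing a reached state through \<open>ws\<close> gives the moment of the
      concatenation \<open>ws @ vs\<close>; shown once for use in both realizations.\<close>
    have moment: "(fm_C \<R> * fm_A_word \<R> ws) *\<^sub>v ((fm_A_word \<R> vs * fm_B \<R> k X) *\<^sub>v u) =
      (fm_C \<R> * (fm_A_word \<R> (ws @ vs) * fm_B \<R> k X)) *\<^sub>v u \<and>
      (fm_A_word \<R> vs * fm_B \<R> k X) *\<^sub>v u \<in> carrier_vec (fm_dim \<R>)"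
      if ws: "ws \<in> fm_words d s" and real: "fm_realization d s \<R>" for ws and \<R> :: "'a fm_real"
    proof -
      note C = fm_realizationD(2)[OF real] and B = fm_realizationD(4)[OF real k X]
        and Aw = fm_A_word_carrier[OF real ws] and Av = fm_A_word_carrier[OF real vs]
      note AvB = mult_carrier_mat[OF Av B]
      have "(fm_C \<R> * fm_A_word \<R> ws) *\<^sub>v ((fm_A_word \<R> vs * fm_B \<R> k X) *\<^sub>v u) =
        (fm_C \<R> * fm_A_word \<R> ws * (fm_A_word \<R> vs * fm_B \<R> k X)) *\<^sub>v u"
        by (rule assoc_mult_mat_vec[OF mult_carrier_mat[OF C Aw] AvB u, symmetric])
      also have "fm_C \<R> * fm_A_word \<R> ws * (fm_A_word \<R> vs * fm_B \<R> k X) =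
        fm_C \<R> * (fm_A_word \<R> (ws @ vs) * fm_B \<R> k X)"
        by (simp only: assoc_mult_mat[OF C Aw AvB] assoc_mult_mat[OF Aw Av B] fm_A_word_append[OF real ws vs])
      finally show ?thesis using mult_mat_vec_carrier[OF AvB u] by blast
    qed
    have "G x ((fm_A_word \<R>2 vs * fm_B \<R>2 k X) *\<^sub>v u)"
      unfolding G_def x O1_def O2_def L_def L'_def
    proof (intro conjI ballI)
      fix ws :: "(nat \<times> 'a mat) list" assume ws: "ws \<in> fm_words d s"
      show "(fm_C \<R>1 * fm_A_word \<R>1 ws) *\<^sub>v ((fm_A_word \<R>1 vs * fm_B \<R>1 k X) *\<^sub>v u) =
        (fm_C \<R>2 * fm_A_word \<R>2 ws) *\<^sub>v ((fm_A_word \<R>2 vs * fm_B \<R>2 k X) *\<^sub>v u)"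
        using moment[OF ws real1] moment[OF ws real2]
          fm_moments_eq[OF vars R1 R2 fm_words_append[OF ws vs] k X] by simp
    qed (use moment[OF vs real1] moment[OF vs real2] in blast)+
    then show "x \<in> {x. \<exists>x'. G x x'}" by blast
  next
    fix x assume "x \<in> {x. \<exists>x'. G x x'}"
    then show "x \<in> carrier_vec L" by (auto simp: G_def)
  qed (use G_zero G_add G_smult in blast)+
  then have "\<exists>x'. G (unit_vec L j) x'" for j
    using unit_vec_carrier[of L j] by blast
  \<comment> \<open>Partners are fixed for unit vectors and become the columns of \<open>M\<close>.
    Vectors related to their image under \<open>M\<close> form a subspace containing the unit
    vectors, hence are all vectors.\<close>
  then obtain g where g: "\<And>j. G (unit_vec L j) (g j)" by metis
  define M where "M = mat L' L (\<lambda>(i, j). g j $ i)"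
  have M: "M \<in> carrier_mat L' L" by (simp add: M_def)
  have "LinearCombinations.module.span class_ring (module_vec TYPE('a) L) (set (unit_vecs L)) \<subseteq>
    {x. G x (M *\<^sub>v x)}"
  proof (rule span_vec_least)
    have "M *\<^sub>v unit_vec L j = g j" if "j < L" for j
      using that g[of j] by (intro eq_vecI) (auto simp: M_def G_def)
    then show "set (unit_vecs L) \<subseteq> {x. G x (M *\<^sub>v x)}" using g by (auto simp: unit_vecs_def)
    show "{x. G x (M *\<^sub>v x)} \<subseteq> carrier_vec L" by (auto simp: G_def)
    have "M *\<^sub>v 0\<^sub>v L = 0\<^sub>v L'" using M by (intro eq_vecI) auto
    then show "0\<^sub>v L \<in> {x. G x (M *\<^sub>v x)}" using G_zero by simp
  next
    fix x y assume "x \<in> {x. G x (M *\<^sub>v x)}" "y \<in> {x. G x (M *\<^sub>v x)}"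
    then show "x + y \<in> {x. G x (M *\<^sub>v x)}"
      using G_add[of x "M *\<^sub>v x" y "M *\<^sub>v y"] mult_add_distrib_mat_vec[OF M, of x y] by (simp add: G_def)
  next
    fix c x assume "x \<in> {x. G x (M *\<^sub>v x)}"
    then show "c \<cdot>\<^sub>v x \<in> {x. G x (M *\<^sub>v x)}"
      using G_smult[of x "M *\<^sub>v x" c] mult_mat_vec[OF M, of x c] by (simp add: G_def)
  qed
  then have GM: "G v (M *\<^sub>v v)" if "v \<in> carrier_vec L" for v
    using that vec_space.span_unit_vecs_is_carrier[where 'a = 'a, of L] by blast
  \<comment> \<open>A kernel vector of \<open>M\<close> is related to 0, so all its outputs vanish
    and observability of \<open>\<R>1\<close> forces it to be 0.\<close>
  have "v = 0\<^sub>v L" if v: "v \<in> carrier_vec L" and Mv: "M *\<^sub>v v = 0\<^sub>v L'" for v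
  proof -
    have "O1 ws *\<^sub>v v = 0\<^sub>v s" if ws: "ws \<in> fm_words d s" for ws
    proof -
      have "O1 ws *\<^sub>v v = O2 ws *\<^sub>v 0\<^sub>v L'" using GM[OF v] ws Mv unfolding G_def by simp
      also have "\<dots> = 0\<^sub>v s" using O2[OF ws] by (intro eq_vecI) auto
      finally show ?thesis .
    qed
    then show ?thesis using obs v unfolding fm_observable_def O1_def L_def by blast
  qed
  then have "L \<le> L'" by (rule injective_mat_dim_le[OF M])
  then show ?thesis by (simp add: L_def L'_def)
qed

theorem theorem2p16:
  fixes d s :: nat
    and R :: "'a::field rexp"
    and Y :: "nat \<Rightarrow> 'a mat"
    and \<R> :: "'a fm_real"
  assumes "d \<ge> 1" and "s \<ge> 1"
    and "rexp_vars R \<subseteq> {..<d}"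
    and "fm_realizes d s Y \<R> R"
  shows "fm_minimal d s Y R \<R> \<longleftrightarrow> fm_controllable d s \<R> \<and> fm_observable d s \<R>"
proof
  have real: "fm_realization d s \<R>" using assms(4) unfolding fm_realizes_def by blast
  assume "fm_minimal d s Y R \<R>"
  then have "\<not> (\<exists>\<R>'. fm_realizes d s Y \<R>' R \<and> fm_dim \<R>' < fm_dim \<R>)"
    unfolding fm_minimal_def by (meson leD)
  then show "fm_controllable d s \<R> \<and> fm_observable d s \<R>"
    using uncontrollable_reduction[OF real _ assms(4)] unobservable_reduction[OF real _ assms(4)] by blast
next
  assume "fm_controllable d s \<R> \<and> fm_observable d s \<R>"
  \<comment> \<open>The competing realization takes the second place, about which neither
    controllability nor observability is known.\<close>
  then show "fm_minimal d s Y R \<R>"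
    using fm_dim_le[OF assms(3,4)] assms(4) unfolding fm_minimal_def by blast
qed

end
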